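(* Let $\hat P_h^{n}=(P_{\mathcal K}^{n},P_{\mathcal F}^{n})\in V_{h,0}^k$, $0\le n\le M$, be the solution of the complete discrete HHO scheme: $\hat P_h^0=\hat I_h^k(g)$ and, for $n\in\{0,1,\dots,M-1\}$ and all $\hat q_h=(q_{\mathcal K},q_{\mathcal F})\in V_{h,0}^k$, $$(\partial_\tau P_{\mathcal K}^n,q_{\mathcal K})+b(\hat P_h^{n+\frac12},\hat q_h)+\mathcal I^{n+\frac12}(\hat q_h)=(f^{n+\frac12},q_{\mathcal K}),$$ where $\mathcal I^{n+\frac12}(\hat q_h)=\tau\sum_{j=0}^{n-1}b(\hat P_h^{j+\frac12},\hat q_h)+\frac{\tau}{2}b(\hat P_h^{n+\frac12},\hat q_h)$ (the sum being zero when $n=0$). Then, for $l\in\{1,2,\dots,M-1\}$, $$\|P_{\mathcal K}^{l+1}\|^2+\tau\sum_{n=0}^{l}\|\hat P_h^{n+\frac12}\|_{1,h}^2\le C\Big(\|g\|^2+\frac{\tau}{2}\sum_{n=0}^{l}\|f^{n+\frac12}\|^2\Big).$$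
   Context: Setting. $\Omega\subset\mathbb R^2$ is a bounded convex polygonal domain, $T>0$, $k\ge0$ is an integer, $g\in H^1(\Omega)$ is the initial datum and $f(t)\in L^2(\Omega)$ the forcing term. $(\cdot,\cdot)$ and $\|\cdot\|$ are the $L^2(\Omega)$ inner product and norm; $(\cdot,\cdot)_K$ and $\langle\cdot,\cdot\rangle_F$ are the $L^2$ inner products on a cell $K$ and on a face $F$. $C>0$ denotes a generic constant independent of $h$ and $\tau$, which may depend on $T$. Time grid. $[0,T]$ is uniformly partitioned with $t_i=i\tau$, $0\le i\le M$, $\tau=T/M$. For a function $\phi$ continuous in time, $\phi^n=\phi(t_n)$; for a sequence $(\theta^n)$, $\partial_\tau\theta^n=(\theta^{n+1}-\theta^n)/\tau$ and $\theta^{n+\frac12}=(\theta^{n+1}+\theta^n)/2$. Mesh. $\mathcal K_h$ is a partition of $\Omega$ into finitely many closed connected polygonal cells $K$ of diameter $h_K$, $h=\max_K h_K$. $\mathcal F_h=\mathcal F_h^o\cup\mathcal F_h^\partial$ is the set of faces (edges), split into interfaces and boundary faces; $\mathcal F_K$ is the set of faces contained in $\partial K$, $h_F$ is the length of $F$, and $\mathbf n_{KF}$ is the unit normal on $F$ outward to $K$. The mesh belongs to a regular family in the usual HHO sense: there is $\rho\in(0,1)$ independent of $h$ such that the mesh admits a matching simplicial submesh in which every simplex has inradius at least $\rho$ times its diameter, and every simplex contained in a cell $K$ has diameter at least $\rho h_K$. Hybrid spaces. $V_h^k=\prod_{K\in\mathcal K_h}\mathcal P_k(K)\times\prod_{F\in\mathcal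 F_h}\mathcal P_k(F)$, where $\mathcal P_k$ denotes polynomials of degree at most $k$; elements are $\hat q_h=(q_{\mathcal K},q_{\mathcal F})$ with $q_{\mathcal K}=(q_K)_K$ (identified with the broken polynomial equal to $q_K$ on $K$) and $q_{\mathcal F}=(q_F)_F$. $V_{h,0}^k$ is the subspace with $q_F=0$ for all $F\in\mathcal F_h^\partial$. The restriction to $K$ is $\hat q_K=(q_K,(q_F)_{F\in\mathcal F_K})\in V_K^k=\mathcal P_k(K)\times\prod_{F\in\mathcal F_K}\mathcal P_k(F)$. With $\pi_K^k,\pi_F^k$ the $L^2$-orthogonal projections onto $\mathcal P_k(K),\mathcal P_k(F)$, $\hat I_h^k(v)=((\pi_K^k v)_K,(\pi_F^k v)_F)$ for $v\in H^1(\Omega)$. Reconstruction, stabilization, bilinear form. $R_K^{k+1}\hat q_K\in\mathcal P_{k+1}(K)$ is the unique solution of $(\nabla R_K^{k+1}\hat q_K,\nabla w)_K=(\nabla q_K,\nabla w)_K+\sum_{F\in\mathcal F_K}\langle q_F-q_K|_F,\mathbf n_{KF}\cdot\nabla w\rangle_F$ for all $w\in\mathcal P_{k+1}(K)$, with $(R_K^{k+1}\hat q_K,1)_K=(q_K,1)_K$. Let $\delta_K\hat q_K=\pi_K^k(R_K^{k+1}\hat q_K-q_K)$, $\delta_{KF}\hat q_K=\pi_F^k(R_K^{k+1}\hat q_K-q_F)$, and $s_K(\hat q_K,\hat r_K)=\sum_{F\in\mathcal F_K}h_F^{-1}\langle(\delta_{KF}-\delta_K)\hat q_K,(\delta_{KF}-\delta_K)\hat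 r_K\rangle_F$. Then $s_h=\sum_K s_K$ and $b(\hat q_h,\hat r_h)=\sum_K(\nabla R_K^{k+1}\hat q_K,\nabla R_K^{k+1}\hat r_K)_K+s_h(\hat q_h,\hat r_h)$, and $\|\hat q_h\|_{1,h}^2=b(\hat q_h,\hat q_h)$, which is a norm on $V_{h,0}^k$. *)

theory Defs
  imports "HOL-Analysis.Analysis"
begin

text \<open>Elements of an L2 space are represented by functions, not by classes modulo null sets.\<close>

definition L2 :: "'a measure \<Rightarrow> ('a \<Rightarrow> real) set" where
  "L2 \<mu> = {u \<in> borel_measurable \<mu>. integrable \<mu> (\<lambda>x. (u x)\<^sup>2)}"

definition l2_inner :: "'a measure \<Rightarrow> ('a \<Rightarrow> real) \<Rightarrow> ('a \<Rightarrow> real) \<Rightarrow> real" where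
  "l2_inner \<mu> u v = (\<integral>x. u x * v x \<partial>\<mu>)"

definition l2_norm :: "'a measure \<Rightarrow> ('a \<Rightarrow> real) \<Rightarrow> real" where
  "l2_norm \<mu> u = sqrt (l2_inner \<mu> u u)"

definition l2_proj :: "'a measure \<Rightarrow> ('a \<Rightarrow> real) set \<Rightarrow> ('a \<Rightarrow> real) \<Rightarrow> 'a \<Rightarrow> real" where
  "l2_proj \<mu> V v = (THE p. p \<in> V \<and> (\<forall>q\<in>V. l2_inner \<mu> p q = l2_inner \<mu> v q))"


type_synonym pt = "real^2"
type_synonym scalar = "pt \<Rightarrow> real"

definition grad :: "scalar \<Rightarrow> pt \<Rightarrow> pt" where
  "grad u x = (\<chi> i. frechet_derivative u (at x) (axis i 1))"

text \<open>\<open>D i j\<close> is the partial derivative of order \<open>i\<close> in the first and \<open>j\<close> in the second variable.\<close>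

definition smooth :: "scalar \<Rightarrow> bool" where
  "smooth \<phi> \<longleftrightarrow> (\<exists>D. D 0 0 = \<phi> \<and>
     (\<forall>i j x. (D i j has_derivative (\<lambda>v. D (Suc i) j x * v$1 + D i (Suc j) x * v$2)) (at x)))"

definition test_function :: "pt set \<Rightarrow> scalar \<Rightarrow> bool" where
  "test_function \<Omega> \<phi> \<longleftrightarrow> smooth \<phi> \<and> (\<exists>S. compact S \<and> S \<subseteq> \<Omega> \<and> (\<forall>x. x \<notin> S \<longrightarrow> \<phi> x = 0))"

definition weak_gradient :: "pt set \<Rightarrow> scalar \<Rightarrow> (pt \<Rightarrow> pt) \<Rightarrow> bool" where
  "weak_gradient \<Omega> u G \<longleftrightarrow>
     (\<forall>i. (\<lambda>x. G x $ i) \<in> L2 (lebesgue_on \<Omega>)) \<and>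
     (\<forall>\<phi> i. test_function \<Omega> \<phi> \<longrightarrow>
        l2_inner (lebesgue_on \<Omega>) u (\<lambda>x. grad \<phi> x $ i)
          = - l2_inner (lebesgue_on \<Omega>) (\<lambda>x. G x $ i) \<phi>)"

definition H1 :: "pt set \<Rightarrow> scalar set" where
  "H1 \<Omega> = {u \<in> L2 (lebesgue_on \<Omega>). \<exists>G. weak_gradient \<Omega> u G}"

text \<open>
  Arc-length measure on a segment; the value does not depend on which of the two orderings of the
  endpoints is chosen.
\<close>

definition arc_measure :: "pt set \<Rightarrow> pt measure" where
  "arc_measure F = (let (a, b) = (SOME e. F = closed_segment (fst e) (snd e)) in
     distr (lebesgue_on {0..dist a b}) borel (\<lambda>s. a + (s / dist a b) *\<^sub>R (b - a)))"

text \<open>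
  The trace on \<open>F\<close> is the continuous extension to \<open>H1\<close> of the restriction of smooth functions.
  It is determined up to null sets of \<open>F\<close>, and \<open>trace\<close> picks a representative.
\<close>

definition is_trace :: "pt set \<Rightarrow> pt set \<Rightarrow> scalar \<Rightarrow> scalar \<Rightarrow> bool" where
  "is_trace \<Omega> F v w \<longleftrightarrow> w \<in> L2 (arc_measure F) \<and>
     (\<exists>G \<phi>. weak_gradient \<Omega> v G \<and> (\<forall>n. smooth (\<phi> n)) \<and>
        (\<lambda>n. l2_norm (lebesgue_on \<Omega>) (\<lambda>x. \<phi> n x - v x)) \<longlonglongrightarrow> 0 \<and>
        (\<forall>i. (\<lambda>n. l2_norm (lebesgue_on \<Omega>) (\<lambda>x. grad (\<phi> n) x $ i - G x $ i)) \<longlonglongrightarrow> 0) \<and>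
        (\<lambda>n. l2_norm (arc_measure F) (\<lambda>x. \<phi> n x - w x)) \<longlonglongrightarrow> 0)"

definition trace :: "pt set \<Rightarrow> pt set \<Rightarrow> scalar \<Rightarrow> scalar" where
  "trace \<Omega> F v = (SOME w. is_trace \<Omega> F v w)"


definition convex_polygonal_domain :: "pt set \<Rightarrow> bool" where
  "convex_polygonal_domain \<Omega> \<longleftrightarrow> \<Omega> \<noteq> {} \<and> (\<exists>P. polytope P \<and> \<Omega> = interior P)"

definition polygonal_region :: "pt set \<Rightarrow> bool" where
  "polygonal_region K \<longleftrightarrow>
     (\<exists>\<T>. finite \<T> \<and> \<T> \<noteq> {} \<and> (\<forall>S\<in>\<T>. 2 simplex S) \<and> K = \<Union>\<T>)"

text \<open>
  The finitely many exceptions are for the endpoints of \<open>F\<close> and for points at which another part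
  of the (possibly nonconvex) cell touches \<open>F\<close> with a vertex.
\<close>

definition outward_normal :: "pt set \<Rightarrow> pt set \<Rightarrow> pt \<Rightarrow> bool" where
  "outward_normal K F n \<longleftrightarrow> norm n = 1 \<and> (\<forall>x\<in>F. \<forall>y\<in>F. n \<bullet> (x - y) = 0) \<and>
     (\<exists>N. finite N \<and>
        (\<forall>x\<in>F - N. \<forall>\<^sub>F t in at_right 0. x - t *\<^sub>R n \<in> K \<and> x + t *\<^sub>R n \<notin> K))"

definition normal :: "pt set \<Rightarrow> pt set \<Rightarrow> pt" where
  "normal K F = (THE n. outward_normal K F n)"

definition cell_faces :: "pt set set \<Rightarrow> pt set \<Rightarrow> pt set set" where
  "cell_faces \<F> K = {F\<in>\<F>. F \<subseteq> frontier K}"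

definition boundary_faces :: "pt set \<Rightarrow> pt set set \<Rightarrow> pt set set" where
  "boundary_faces \<Omega> \<F> = {F\<in>\<F>. F \<subseteq> frontier \<Omega>}"

definition interfaces :: "pt set set \<Rightarrow> pt set set \<Rightarrow> pt set set" where
  "interfaces \<K> \<F> = {F\<in>\<F>. \<exists>K\<in>\<K>. \<exists>L\<in>\<K>. K \<noteq> L \<and> F \<subseteq> frontier K \<inter> frontier L}"

text \<open>
  Cells need not be convex, and an edge of a cell may be split into several faces (hanging nodes).
  Faces are closed segments whose relative interiors are disjoint and which cover the mesh skeleton.
  The last condition says that a cell lies on one and the same side along each of its faces, so that
  it has a constant outward unit normal there.
\<close>

definition polygonal_mesh :: "pt set \<Rightarrow> pt set set \<Rightarrow> pt set set \<Rightarrow> bool" where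
  "polygonal_mesh \<Omega> \<K> \<F> \<longleftrightarrow>
     finite \<K> \<and>
     (\<forall>K\<in>\<K>. closed K \<and> connected K \<and> polygonal_region K) \<and>
     \<Union>\<K> = closure \<Omega> \<and>
     pairwise (\<lambda>K L. interior K \<inter> interior L = {}) \<K> \<and>
     finite \<F> \<and>
     (\<forall>F\<in>\<F>. \<exists>a b. a \<noteq> b \<and> F = closed_segment a b) \<and>
     pairwise (\<lambda>F E. rel_interior F \<inter> rel_interior E = {}) \<F> \<and>
     \<Union>\<F> = (\<Union>K\<in>\<K>. frontier K) \<and>
     \<F> = interfaces \<K> \<F> \<union> boundary_faces \<Omega> \<F> \<and>
     (\<forall>F\<in>\<F>. \<exists>K\<in>\<K>. F \<in> cell_faces \<F> K) \<and>
     (\<forall>K\<in>\<K>. \<forall>F\<in>cell_faces \<F> K. \<exists>n. outward_normal K F n)"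

definition inradius :: "pt set \<Rightarrow> real" where
  "inradius S = Sup {r. 0 \<le> r \<and> (\<exists>c. cball c r \<subseteq> S)}"

text \<open>
  \<open>triangulation\<close> already requires that any two simplices meet in a common (possibly empty) face.
\<close>

definition matching_submesh :: "pt set \<Rightarrow> pt set set \<Rightarrow> pt set set \<Rightarrow> pt set set \<Rightarrow> bool" where
  "matching_submesh \<Omega> \<K> \<F> \<T> \<longleftrightarrow>
     triangulation \<T> \<and> (\<forall>S\<in>\<T>. 2 simplex S) \<and> \<Union>\<T> = closure \<Omega> \<and>
     (\<forall>S\<in>\<T>. \<exists>K\<in>\<K>. S \<subseteq> K) \<and>
     (\<forall>S\<in>\<T>. \<forall>e. e edge_of S \<longrightarrow>
        (\<forall>F\<in>\<F>. e \<subseteq> F \<or> rel_interior e \<inter> rel_interior F = {}))"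

definition regular_mesh :: "real \<Rightarrow> pt set \<Rightarrow> pt set set \<Rightarrow> pt set set \<Rightarrow> bool" where
  "regular_mesh \<rho> \<Omega> \<K> \<F> \<longleftrightarrow> polygonal_mesh \<Omega> \<K> \<F> \<and>
     (\<exists>\<T>. matching_submesh \<Omega> \<K> \<F> \<T> \<and>
        (\<forall>S\<in>\<T>. inradius S \<ge> \<rho> * diameter S) \<and>
        (\<forall>K\<in>\<K>. \<forall>S\<in>\<T>. S \<subseteq> K \<longrightarrow> diameter S \<ge> \<rho> * diameter K))"


text \<open>
  Cells have nonempty interior, so a polynomial on a cell is identified with the polynomial on the
  whole plane that extends it. A polynomial on a face is extended by zero off the face (its extension
  to the plane as a polynomial would not be unique).
\<close>

definition Pk :: "nat \<Rightarrow> scalar set" where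
  "Pk k = {p. \<exists>c. p = (\<lambda>x. \<Sum>i\<le>k. \<Sum>j\<le>k - i. c i j * (x$1)^i * (x$2)^j)}"

definition Pk_face :: "nat \<Rightarrow> pt set \<Rightarrow> scalar set" where
  "Pk_face k F = {q. \<exists>p\<in>Pk k. q = (\<lambda>x. if x \<in> F then p x else 0)}"

definition proj_cell :: "nat \<Rightarrow> pt set \<Rightarrow> scalar \<Rightarrow> scalar" where
  "proj_cell k K = l2_proj (lebesgue_on K) (Pk k)"

definition proj_face :: "nat \<Rightarrow> pt set \<Rightarrow> scalar \<Rightarrow> scalar" where
  "proj_face k F = l2_proj (arc_measure F) (Pk_face k F)"

text \<open>
  A hybrid function is a pair of families indexed by the cells and by the faces; both families
  vanish at indices that are not cells, respectively faces, of the mesh.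
\<close>

type_synonym hybrid = "(pt set \<Rightarrow> scalar) \<times> (pt set \<Rightarrow> scalar)"

definition Vh :: "nat \<Rightarrow> pt set set \<Rightarrow> pt set set \<Rightarrow> hybrid set" where
  "Vh k \<K> \<F> = {q.
     (\<forall>K. if K \<in> \<K> then fst q K \<in> Pk k else fst q K = (\<lambda>_. 0)) \<and>
     (\<forall>F. if F \<in> \<F> then snd q F \<in> Pk_face k F else snd q F = (\<lambda>_. 0))}"

definition Vh0 :: "nat \<Rightarrow> pt set \<Rightarrow> pt set set \<Rightarrow> pt set set \<Rightarrow> hybrid set" where
  "Vh0 k \<Omega> \<K> \<F> = {q \<in> Vh k \<K> \<F>. \<forall>F\<in>boundary_faces \<Omega> \<F>. snd q F = (\<lambda>_. 0)}"

definition Ih :: "nat \<Rightarrow> pt set \<Rightarrow> pt set set \<Rightarrow> pt set set \<Rightarrow> scalar \<Rightarrow> hybrid" where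
  "Ih k \<Omega> \<K> \<F> v =
     (\<lambda>K. if K \<in> \<K> then proj_cell k K v else (\<lambda>_. 0),
      \<lambda>F. if F \<in> \<F> then proj_face k F (trace \<Omega> F v) else (\<lambda>_. 0))"

text \<open>The value on the mesh skeleton, which is a null set, is immaterial and taken to be zero.\<close>

definition broken :: "pt set set \<Rightarrow> hybrid \<Rightarrow> scalar" where
  "broken \<K> q x = (\<Sum>K\<in>\<K>. indicator (interior K) x * fst q K x)"


definition reconstruction :: "nat \<Rightarrow> pt set set \<Rightarrow> pt set \<Rightarrow> hybrid \<Rightarrow> scalar" where
  "reconstruction k \<F> K q = (THE r. r \<in> Pk (k + 1) \<and>
     (\<forall>w\<in>Pk (k + 1).
        (\<integral>x. grad r x \<bullet> grad w x \<partial>lebesgue_on K) =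
        (\<integral>x. grad (fst q K) x \<bullet> grad w x \<partial>lebesgue_on K) +
        (\<Sum>F\<in>cell_faces \<F> K.
           l2_inner (arc_measure F) (\<lambda>x. snd q F x - fst q K x) (\<lambda>x. normal K F \<bullet> grad w x))) \<and>
     l2_inner (lebesgue_on K) r (\<lambda>_. 1) = l2_inner (lebesgue_on K) (fst q K) (\<lambda>_. 1))"

definition delta_cell :: "nat \<Rightarrow> pt set set \<Rightarrow> pt set \<Rightarrow> hybrid \<Rightarrow> scalar" where
  "delta_cell k \<F> K q = proj_cell k K (\<lambda>x. reconstruction k \<F> K q x - fst q K x)"

definition delta_face :: "nat \<Rightarrow> pt set set \<Rightarrow> pt set \<Rightarrow> pt set \<Rightarrow> hybrid \<Rightarrow> scalar" where
  "delta_face k \<F> K F q = proj_face k F (\<lambda>x. reconstruction k \<F> K q x - snd q F x)"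

definition stab_cell :: "nat \<Rightarrow> pt set set \<Rightarrow> pt set \<Rightarrow> hybrid \<Rightarrow> hybrid \<Rightarrow> real" where
  "stab_cell k \<F> K q r = (\<Sum>F\<in>cell_faces \<F> K.
     inverse (diameter F) *
     l2_inner (arc_measure F)
       (\<lambda>x. delta_face k \<F> K F q x - delta_cell k \<F> K q x)
       (\<lambda>x. delta_face k \<F> K F r x - delta_cell k \<F> K r x))"

definition stab :: "nat \<Rightarrow> pt set set \<Rightarrow> pt set set \<Rightarrow> hybrid \<Rightarrow> hybrid \<Rightarrow> real" where
  "stab k \<K> \<F> q r = (\<Sum>K\<in>\<K>. stab_cell k \<F> K q r)"

definition bform :: "nat \<Rightarrow> pt set set \<Rightarrow> pt set set \<Rightarrow> hybrid \<Rightarrow> hybrid \<Rightarrow> real" where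
  "bform k \<K> \<F> q r =
     (\<Sum>K\<in>\<K>. \<integral>x. grad (reconstruction k \<F> K q) x \<bullet> grad (reconstruction k \<F> K r) x \<partial>lebesgue_on K)
     + stab k \<K> \<F> q r"

definition norm1h :: "nat \<Rightarrow> pt set set \<Rightarrow> pt set set \<Rightarrow> hybrid \<Rightarrow> real" where
  "norm1h k \<K> \<F> q = sqrt (bform k \<K> \<F> q q)"


definition half_scalar :: "(nat \<Rightarrow> scalar) \<Rightarrow> nat \<Rightarrow> scalar" where
  "half_scalar u n = (\<lambda>x. (u (Suc n) x + u n x) / 2)"

definition half_hybrid :: "(nat \<Rightarrow> hybrid) \<Rightarrow> nat \<Rightarrow> hybrid" where
  "half_hybrid P n =
     (\<lambda>K. half_scalar (\<lambda>m. fst (P m) K) n, \<lambda>F. half_scalar (\<lambda>m. snd (P m) F) n)"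

definition time_diff :: "real \<Rightarrow> (nat \<Rightarrow> scalar) \<Rightarrow> nat \<Rightarrow> scalar" where
  "time_diff \<tau> u n = (\<lambda>x. (u (Suc n) x - u n x) / \<tau>)"

definition memory_term ::
  "nat \<Rightarrow> pt set set \<Rightarrow> pt set set \<Rightarrow> real \<Rightarrow> (nat \<Rightarrow> hybrid) \<Rightarrow> nat \<Rightarrow> hybrid \<Rightarrow> real" where
  "memory_term k \<K> \<F> \<tau> P n q =
     \<tau> * (\<Sum>j<n. bform k \<K> \<F> (half_hybrid P j) q)
     + \<tau> / 2 * bform k \<K> \<F> (half_hybrid P n) q"

definition hho_solution ::
  "nat \<Rightarrow> pt set \<Rightarrow> pt set set \<Rightarrow> pt set set \<Rightarrow> real \<Rightarrow> nat \<Rightarrow> scalar \<Rightarrow> (real \<Rightarrow> scalar)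
     \<Rightarrow> (nat \<Rightarrow> hybrid) \<Rightarrow> bool" where
  "hho_solution k \<Omega> \<K> \<F> \<tau> M g f P \<longleftrightarrow>
     (\<forall>n\<le>M. P n \<in> Vh0 k \<Omega> \<K> \<F>) \<and>
     P 0 = Ih k \<Omega> \<K> \<F> g \<and>
     (\<forall>n<M. \<forall>q\<in>Vh0 k \<Omega> \<K> \<F>.
        l2_inner (lebesgue_on \<Omega>) (time_diff \<tau> (\<lambda>m. broken \<K> (P m)) n) (broken \<K> q)
        + bform k \<K> \<F> (half_hybrid P n) q
        + memory_term k \<K> \<F> \<tau> P n q
        = l2_inner (lebesgue_on \<Omega>) (half_scalar (\<lambda>m. f (real m * \<tau>)) n) (broken \<K> q))"

end

theory Submission
  imports Defs
begin

text \<open>Testing the scheme with the half-step iterates \<open>Q n\<close> turns the memory term into a multiple of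
  the increments of the double sums of \<open>b (Q i) (Q j)\<close> over \<open>i, j < n\<close>, which telescope and are
  nonnegative because \<open>b\<close> is a Gram form. The source is absorbed by Young's inequality with weight
  \<open>2 T\<close> at the time of largest energy, and the initial energy is at most that of \<open>g\<close> since the initial
  value is a cellwise \<open>L\<^sup>2\<close> projection. As projections and reconstructions are given by \<open>THE\<close>, their
  existence and uniqueness (by finite-dimensional Riesz representation and unique continuation of
  polynomials) is needed to see that all integrands in \<open>b\<close> are integrable.\<close>

section \<open>Riesz representation in finite-dimensional function spaces\<close>

text \<open>The obstacle is totality: the integral of a non-integrable function is 0, and a
  description without a unique solution is an arbitrary function. So the formula for
  \<open>b\<close> does not by itself make a double sum of its values nonnegative: sums may be moved
  inside the integrals, exposing a square, only once integrability is known. Hence all projections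
  and reconstructions entering \<open>b\<close> are shown to be polynomials. The telescoping hinges
  on the weight \<open>\<tau> / 2\<close> of the newest memory term. Enlarging the square of index
  pairs by one adds a row and a column, equal by symmetry, and one corner: twice the older terms
  plus the newest one, which is exactly the proportion in the memory term. The weight 2 T is chosen
  because each step charges \<open>\<tau> / (2 * T)\<close> times the largest energy and at most T /
  \<open>\<tau>\<close> steps occur, so one half of that energy is charged in total. Absorbing this
  half doubles the remaining terms and gives the coefficients 2 for the initial energy and 4 T for
  \<open>\<tau>\<close> times the source sum, that is, 8 T when the sum carries
  \<open>\<tau> / 2\<close>.\<close>

definition fun_subspace :: "('a \<Rightarrow> real) set \<Rightarrow> bool" where
  "fun_subspace V \<longleftrightarrow> (\<lambda>_. 0) \<in> V \<and> (\<forall>u\<in>V. \<forall>v\<in>V. \<forall>a b. (\<lambda>x. a * u x + b * v x) \<in> V)"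

text \<open>Linearity is relative to \<open>V\<close> because integral functionals are additive only
  where the integrands are integrable.\<close>

definition linear_on_funs :: "('a \<Rightarrow> real) set \<Rightarrow> (('a \<Rightarrow> real) \<Rightarrow> real) \<Rightarrow> bool" where
  "linear_on_funs V L \<longleftrightarrow>
     (\<forall>u\<in>V. \<forall>v\<in>V. \<forall>a b. L (\<lambda>x. a * u x + b * v x) = a * L u + b * L v)"

text \<open>Only semidefinite: on functions, the L2 product vanishes at null functions, and the
  gradient form vanishes at constants.\<close>

definition semi_inner :: "('a \<Rightarrow> real) set \<Rightarrow> (('a \<Rightarrow> real) \<Rightarrow> ('a \<Rightarrow> real) \<Rightarrow> real) \<Rightarrow> bool" where
  "semi_inner V B \<longleftrightarrow> fun_subspace V \<and> (\<forall>w\<in>V. linear_on_funs V (\<lambda>u. B u w)) \<and>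
     (\<forall>u\<in>V. \<forall>v\<in>V. B u v = B v u) \<and> (\<forall>u\<in>V. 0 \<le> B u u)"

text \<open>The family may be linearly dependent, as monomials in two variables are on a
  segment.\<close>

definition fun_span :: "'i set \<Rightarrow> ('i \<Rightarrow> 'a \<Rightarrow> real) \<Rightarrow> ('a \<Rightarrow> real) set" where
  "fun_span I \<phi> = range (\<lambda>c x. \<Sum>i\<in>I. c i * \<phi> i x)"

lemma fun_subspaceD:
  assumes "fun_subspace V"
  shows "(\<lambda>_. 0) \<in> V"
    and "u \<in> V \<Longrightarrow> v \<in> V \<Longrightarrow> (\<lambda>x. a * u x + b * v x) \<in> V"
    and "u \<in> V \<Longrightarrow> v \<in> V \<Longrightarrow> (\<lambda>x. u x + v x) \<in> V"
    and "u \<in> V \<Longrightarrow> v \<in> V \<Longrightarrow> (\<lambda>x. u x - v x) \<in> V"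
    and "u \<in> V \<Longrightarrow> (\<lambda>x. a * u x) \<in> V"
proof -
  have *: "(\<lambda>x. a * u x + b * v x) \<in> V" if "u \<in> V" "v \<in> V" for a b u v
    using assms that by (simp add: fun_subspace_def)
  show "(\<lambda>_. 0) \<in> V"
    using assms by (simp add: fun_subspace_def)
  show "(\<lambda>x. a * u x + b * v x) \<in> V" if "u \<in> V" "v \<in> V"
    using *[OF that] .
  show "(\<lambda>x. u x + v x) \<in> V" if "u \<in> V" "v \<in> V"
    using *[OF that, of 1 1] by simp
  show "(\<lambda>x. u x - v x) \<in> V" if "u \<in> V" "v \<in> V"
    using *[OF that, of 1 "-1"] by simp
  show "(\<lambda>x. a * u x) \<in> V" if "u \<in> V"
    using *[OF that that, of a 0] by simp
qed

lemma fun_subspace_sum: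
  assumes "fun_subspace V" "\<And>i. i \<in> I \<Longrightarrow> u i \<in> V"
  shows "(\<lambda>x. \<Sum>i\<in>I. c i * u i x) \<in> V"
  using assms(2)
proof (induction I rule: infinite_finite_induct)
  case (insert i I)
  then show ?case
    using fun_subspaceD(2)[OF assms(1), of "u i" "\<lambda>x. \<Sum>i\<in>I. c i * u i x" "c i" 1] by simp
qed (simp_all add: fun_subspaceD(1)[OF assms(1)])

lemma fun_subspace_fun_span: "fun_subspace (fun_span I \<phi>)"
  unfolding fun_subspace_def
proof (intro conjI ballI allI)
  show "(\<lambda>_. 0) \<in> fun_span I \<phi>"
    unfolding fun_span_def by (rule range_eqI[of _ _ "\<lambda>_. 0"]) simp
next
  fix u v and a b :: real
  assume "u \<in> fun_span I \<phi>" "v \<in> fun_span I \<phi>"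
  then obtain c d where "u = (\<lambda>x. \<Sum>i\<in>I. c i * \<phi> i x)" "v = (\<lambda>x. \<Sum>i\<in>I. d i * \<phi> i x)"
    unfolding fun_span_def by blast
  then show "(\<lambda>x. a * u x + b * v x) \<in> fun_span I \<phi>"
    unfolding fun_span_def
    by (intro range_eqI[of _ _ "\<lambda>i. a * c i + b * d i"])
      (simp add: sum_distrib_left sum.distrib ring_distribs mult.assoc)
qed

lemma fun_span_insertE:
  assumes "finite I" "m \<notin> I" "q \<in> fun_span (insert m I) \<phi>"
  obtains a r where "r \<in> fun_span I \<phi>" "q = (\<lambda>x. a * \<phi> m x + r x)"
proof -
  obtain c where c: "q = (\<lambda>x. \<Sum>i\<in>insert m I. c i * \<phi> i x)"
    using assms(3) unfolding fun_span_def by blast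
  show thesis
    by (rule that[of "\<lambda>x. \<Sum>i\<in>I. c i * \<phi> i x" "c m"])
      (use c assms in \<open>auto simp: fun_span_def\<close>)
qed

lemma fun_span_base:
  assumes "finite I" "m \<in> I"
  shows "\<phi> m \<in> fun_span I \<phi>"
  unfolding fun_span_def
  by (rule range_eqI[of _ _ "\<lambda>i. if i = m then 1 else 0"])
    (use assms in \<open>simp add: if_distrib[of "\<lambda>c. c * _"] cong: if_cong\<close>)

lemma fun_span_mono:
  assumes "finite J" "I \<subseteq> J"
  shows "fun_span I \<phi> \<subseteq> fun_span J \<phi>"
proof
  fix q assume "q \<in> fun_span I \<phi>"
  then obtain c where c: "q = (\<lambda>x. \<Sum>i\<in>I. c i * \<phi> i x)"
    unfolding fun_span_def by blast
  have "q = (\<lambda>x. \<Sum>i\<in>J. (if i \<in> I then c i else 0) * \<phi> i x)"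
    unfolding c
    by (rule ext, rule sum.mono_neutral_cong_left) (use assms in auto)
  then show "q \<in> fun_span J \<phi>"
    unfolding fun_span_def by (rule range_eqI[of _ _ "\<lambda>i. if i \<in> I then c i else 0"])
qed

lemma linear_on_funsD:
  assumes "linear_on_funs V L" "u \<in> V" "v \<in> V"
  shows "L (\<lambda>x. a * u x + b * v x) = a * L u + b * L v"
    and "L (\<lambda>x. u x + v x) = L u + L v"
    and "L (\<lambda>x. u x - v x) = L u - L v"
    and "L (\<lambda>x. a * u x) = a * L u"
proof -
  have *: "L (\<lambda>x. a * u x + b * v x) = a * L u + b * L v" for a b
    using assms by (simp add: linear_on_funs_def)
  show "L (\<lambda>x. a * u x + b * v x) = a * L u + b * L v"
    by (rule *)
  show "L (\<lambda>x. u x + v x) = L u + L v"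
    using *[of 1 1] by simp
  show "L (\<lambda>x. u x - v x) = L u - L v"
    using *[of 1 "-1"] by simp
  show "L (\<lambda>x. a * u x) = a * L u"
    using *[of a 0] by simp
qed

lemma linear_on_funs_subset: "linear_on_funs V L \<Longrightarrow> W \<subseteq> V \<Longrightarrow> linear_on_funs W L"
  unfolding linear_on_funs_def by blast

lemma linear_on_funs_add:
  "linear_on_funs V L \<Longrightarrow> linear_on_funs V L' \<Longrightarrow> linear_on_funs V (\<lambda>u. L u + L' u)"
  unfolding linear_on_funs_def by (simp add: algebra_simps)

lemma linear_on_funs_sum:
  assumes "\<And>i. i \<in> I \<Longrightarrow> linear_on_funs V (L i)"
  shows "linear_on_funs V (\<lambda>u. \<Sum>i\<in>I. L i u)"
  using assms
proof (induction I rule: infinite_finite_induct)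
  case (insert i I)
  then show ?case
    using linear_on_funs_add[of V "L i" "\<lambda>u. \<Sum>i\<in>I. L i u"] by simp
qed (simp_all add: linear_on_funs_def)

lemma semi_inner_subset:
  "semi_inner V B \<Longrightarrow> fun_subspace W \<Longrightarrow> W \<subseteq> V \<Longrightarrow> semi_inner W B"
  unfolding semi_inner_def using linear_on_funs_subset by (metis subsetD)

lemma semi_innerD:
  assumes "semi_inner V B"
  shows "fun_subspace V"
    and "w \<in> V \<Longrightarrow> linear_on_funs V (\<lambda>u. B u w)"
    and "w \<in> V \<Longrightarrow> linear_on_funs V (\<lambda>u. B w u)"
    and "u \<in> V \<Longrightarrow> v \<in> V \<Longrightarrow> B u v = B v u"
    and "u \<in> V \<Longrightarrow> 0 \<le> B u u"
proof -
  show V: "fun_subspace V" and *: "w \<in> V \<Longrightarrow> linear_on_funs V (\<lambda>u. B u w)"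
    and s: "u \<in> V \<Longrightarrow> v \<in> V \<Longrightarrow> B u v = B v u" and "u \<in> V \<Longrightarrow> 0 \<le> B u u" for w u v
    using assms by (simp_all add: semi_inner_def)
  show "linear_on_funs V (\<lambda>u. B w u)" if "w \<in> V"
    using *[OF that] s[OF that] fun_subspaceD(2)[OF V] unfolding linear_on_funs_def by simp
qed

text \<open>Along \<open>u + t e\<close> the form takes the values \<open>B u u + 2 t B e u\<close>,
  which are affine in \<open>t\<close>; nonnegativity forces the slope to vanish. The chosen
  \<open>t\<close> would give the value -1.\<close>

lemma semi_inner_null:
  assumes B: "semi_inner V B" and e: "e \<in> V" "B e e = 0" and u: "u \<in> V"
  shows "B e u = 0"
proof (rule ccontr)
  assume nz: "B e u \<noteq> 0"
  define t where "t = - (B u u + 1) / (2 * B e u)"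
  have V: "fun_subspace V"
    by (rule semi_innerD(1)[OF B])
  let ?z = "\<lambda>x. 1 * u x + t * e x"
  have z: "?z \<in> V"
    by (rule fun_subspaceD(2)[OF V u e(1)])
  have "B ?z ?z = B u ?z + t * B e ?z"
    using linear_on_funsD(1)[OF semi_innerD(2)[OF B z] u e(1), of 1 t] by simp
  also have "B u ?z = B u u + t * B u e"
    using linear_on_funsD(1)[OF semi_innerD(3)[OF B u] u e(1), of 1 t] by simp
  also have "B e ?z = B e u + t * B e e"
    using linear_on_funsD(1)[OF semi_innerD(3)[OF B e(1)] u e(1), of 1 t] by simp
  finally have "B ?z ?z = B u u + 2 * t * B e u"
    using e(2) semi_innerD(4)[OF B u e(1)] by simp
  also have "\<dots> = - 1"
    using nz by (simp add: t_def field_simps)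
  finally show False
    using semi_innerD(5)[OF B z] by simp
qed

text \<open>Gram--Schmidt: the representer on the larger span corrects the one on the smaller span by a
  multiple of \<open>e\<close>, the component of the new function orthogonal to the smaller span.\<close>

lemma riesz_fun_span:
  assumes B: "semi_inner V B" and "finite I" "fun_span I \<phi> \<subseteq> V"
    and "linear_on_funs V L" "\<And>u. u \<in> V \<Longrightarrow> B u u = 0 \<Longrightarrow> L u = 0"
  shows "\<exists>p\<in>fun_span I \<phi>. \<forall>q\<in>fun_span I \<phi>. B p q = L q"
  using assms(2-)
proof (induction I arbitrary: L rule: finite_induct)
  case empty
  have "fun_span {} \<phi> = {\<lambda>_. 0}"
    by (auto simp: fun_span_def)
  moreover have "(\<lambda>_. 0) \<in> V"
    by (rule fun_subspaceD(1)[OF semi_innerD(1)[OF B]])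
  then have "B (\<lambda>_. 0) (\<lambda>_. 0) = 0" "L (\<lambda>_. 0) = 0"
    using linear_on_funsD(4)[OF semi_innerD(2)[OF B], where a = 0]
      linear_on_funsD(4)[OF empty.prems(2), where a = 0]
    by force+
  ultimately show ?case by simp
next
  case (insert m I)
  let ?W = "fun_span I \<phi>" and ?W' = "fun_span (insert m I) \<phi>"
  have WW': "?W \<subseteq> ?W'"
    by (rule fun_span_mono) (use insert in auto)
  then have WV: "?W \<subseteq> V"
    using insert.prems(1) by blast
  have m: "\<phi> m \<in> ?W'"
    by (rule fun_span_base) (use insert in auto)
  then have mV: "\<phi> m \<in> V"
    using insert.prems(1) by blast
  obtain p0 where p0: "p0 \<in> ?W" "\<And>q. q \<in> ?W \<Longrightarrow> B p0 q = L q"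
    using insert.IH[OF WV insert.prems(2,3)] by blast
  \<comment> \<open>\<open>p1\<close> is the orthogonal projection of the new function onto the
    smaller span. It comes from the induction hypothesis applied to the functional
    \<open>B (\<phi> m)\<close>, which is why the induction generalises over
    \<open>L\<close>.\<close>
  obtain p1 where p1: "p1 \<in> ?W" "\<And>q. q \<in> ?W \<Longrightarrow> B p1 q = B (\<phi> m) q"
  proof -
    have "\<exists>p\<in>?W. \<forall>q\<in>?W. B p q = B (\<phi> m) q"
    proof (rule insert.IH[OF WV semi_innerD(3)[OF B mV]])
      show "B (\<phi> m) u = 0" if "u \<in> V" "B u u = 0" for u
        using semi_inner_null[OF B that mV] semi_innerD(4)[OF B mV that(1)] by simp
    qed
    then show thesis using that by blast
  qed
  define e where "e = (\<lambda>x. \<phi> m x - p1 x)"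
  note sub' = fun_subspaceD[OF fun_subspace_fun_span[of "insert m I" \<phi>]]
  note sub = fun_subspaceD[OF fun_subspace_fun_span[of I \<phi>]]
  have e: "e \<in> ?W'"
    unfolding e_def using sub'(4) m p1(1) WW' by blast
  then have eV: "e \<in> V"
    using insert.prems(1) by blast
  have eW: "B e q = 0" if "q \<in> ?W" for q
    unfolding e_def
    using linear_on_funsD(3)[OF semi_innerD(2)[OF B] mV, of q p1] p1 that WV by auto
  have We: "B q e = 0" if "q \<in> ?W" for q
    using eW[OF that] semi_innerD(4)[OF B eV, of q] that WV by auto
  have dec: "\<exists>a r. r \<in> ?W \<and> q = (\<lambda>x. a * e x + 1 * r x)" if q: "q \<in> ?W'" for q
  proof -
    obtain a r where r: "r \<in> ?W" "q = (\<lambda>x. a * \<phi> m x + r x)"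
      using fun_span_insertE[OF insert.hyps q] by metis
    then show ?thesis
      by (intro exI[of _ a] exI[of _ "\<lambda>x. a * p1 x + 1 * r x"])
        (use sub(2)[OF p1(1) r(1), of a 1] in \<open>simp add: e_def algebra_simps\<close>)
  qed
  \<comment> \<open>If \<open>e\<close> is a null vector, the compatibility hypothesis gives
    \<open>L e = 0\<close>, so the default 0 still satisfies \<open>t * B e e = L e\<close>.\<close>
  define t where "t = (if B e e = 0 then 0 else L e / B e e)"
  have t: "t * B e e = L e"
    using insert.prems(3)[OF eV] by (simp add: t_def)
  define p where "p = (\<lambda>x. 1 * p0 x + t * e x)"
  have pW: "p \<in> ?W'"
    unfolding p_def by (rule sub'(2)) (use p0 WW' e in auto)
  show ?case
  proof (intro bexI[OF _ pW] ballI)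
    fix q assume "q \<in> ?W'"
    then obtain a r where r: "r \<in> ?W" and q: "q = (\<lambda>x. a * e x + 1 * r x)"
      using dec by blast
    have rV: "r \<in> V" and p0V: "p0 \<in> V" and pV: "p \<in> V"
      using r p0(1) WV pW insert.prems(1) by auto
    have *: "B p z = B p0 z + t * B e z" if "z \<in> V" for z
      unfolding p_def using linear_on_funsD(1)[OF semi_innerD(2)[OF B that] p0V eV, of 1 t] by simp
    have "B p q = a * B p e + B p r"
      unfolding q using linear_on_funsD(1)[OF semi_innerD(3)[OF B pV] eV rV, of a 1] by simp
    also have "\<dots> = a * L e + L r"
      using *[OF eV] *[OF rV] We[OF p0(1)] eW[OF r] p0(2)[OF r] t by simp
    also have "\<dots> = L q"
      unfolding q using linear_on_funsD(1)[OF insert.prems(2) eV rV, of a 1] by simp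
    finally show "B p q = L q" .
  qed
qed

section \<open>Square integrable functions and projections\<close>

lemma L2_integrable_mult:
  assumes "u \<in> L2 \<mu>" "v \<in> L2 \<mu>"
  shows "integrable \<mu> (\<lambda>x. u x * v x)"
proof (rule Bochner_Integration.integrable_bound)
  show "integrable \<mu> (\<lambda>x. (u x)\<^sup>2 + (v x)\<^sup>2)"
    using assms by (auto simp: L2_def)
  show "(\<lambda>x. u x * v x) \<in> borel_measurable \<mu>"
    using assms by (auto simp: L2_def)
  have "\<bar>a * b\<bar> \<le> a\<^sup>2 + b\<^sup>2" for a b :: real
    using sum_squares_bound[of "\<bar>a\<bar>" "\<bar>b\<bar>"] abs_ge_zero[of "a * b"]
    unfolding abs_mult power2_abs by linarith
  then show "AE x in \<mu>. norm (u x * v x) \<le> norm ((u x)\<^sup>2 + (v x)\<^sup>2)"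
    by auto
qed

lemma fun_subspace_L2: "fun_subspace (L2 \<mu>)"
  unfolding fun_subspace_def
proof (intro conjI ballI allI)
  show "(\<lambda>_. 0) \<in> L2 \<mu>" by (simp add: L2_def)
next
  fix u v a b assume uv: "u \<in> L2 \<mu>" "v \<in> L2 \<mu>"
  have "integrable \<mu> (\<lambda>x. a\<^sup>2 * (u x)\<^sup>2 + 2 * a * b * (u x * v x) + b\<^sup>2 * (v x)\<^sup>2)"
    using uv L2_integrable_mult[OF uv]
    by (intro Bochner_Integration.integrable_add integrable_mult_right) (auto simp: L2_def)
  then have "integrable \<mu> (\<lambda>x. (a * u x + b * v x)\<^sup>2)"
    by (rule Bochner_Integration.integrable_cong[THEN iffD1, rotated -1])
      (simp_all add: power2_eq_square algebra_simps)
  then show "(\<lambda>x. a * u x + b * v x) \<in> L2 \<mu>"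
    using uv by (auto simp: L2_def)
qed

lemma semi_inner_L2: "semi_inner (L2 \<mu>) (l2_inner \<mu>)"
  unfolding semi_inner_def linear_on_funs_def
proof (intro conjI ballI allI fun_subspace_L2)
  fix w u v a b assume *: "w \<in> L2 \<mu>" "u \<in> L2 \<mu>" "v \<in> L2 \<mu>"
  have "l2_inner \<mu> (\<lambda>x. a * u x + b * v x) w = (\<integral>x. a * (u x * w x) + b * (v x * w x) \<partial>\<mu>)"
    unfolding l2_inner_def by (simp add: algebra_simps)
  also have "\<dots> = a * l2_inner \<mu> u w + b * l2_inner \<mu> v w"
    unfolding l2_inner_def using L2_integrable_mult *
    by (subst Bochner_Integration.integral_add) auto
  finally show "l2_inner \<mu> (\<lambda>x. a * u x + b * v x) w = a * l2_inner \<mu> u w + b * l2_inner \<mu> v w" .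
qed (auto simp: l2_inner_def mult.commute)

text \<open>Two candidates for the projection differ by a null element of \<open>V\<close>, and
  definiteness on \<open>V\<close> makes it zero as a function, so \<open>THE\<close> is justified.
  The contraction is \<open>0 \<le> |v - p|^2 = |v|^2 - |p|^2\<close>, by orthogonality of
  \<open>v - p\<close> to \<open>p\<close>.\<close>

lemma
  assumes V: "V = fun_span I \<phi>" and "finite I" and VL: "V \<subseteq> L2 \<mu>"
    and def: "\<And>u. u \<in> V \<Longrightarrow> l2_inner \<mu> u u = 0 \<Longrightarrow> u = (\<lambda>_. 0)" and v: "v \<in> L2 \<mu>"
  shows l2_proj_in: "l2_proj \<mu> V v \<in> V"
    and l2_proj_le: "l2_inner \<mu> (l2_proj \<mu> V v) (l2_proj \<mu> V v) \<le> l2_inner \<mu> v v"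
proof -
  let ?B = "l2_inner \<mu>"
  have sV: "fun_subspace V"
    unfolding V by (rule fun_subspace_fun_span)
  have B: "semi_inner V ?B"
    by (rule semi_inner_subset[OF semi_inner_L2 sV VL])
  have "\<exists>p\<in>V. \<forall>q\<in>V. ?B p q = ?B v q"
    unfolding V
  proof (rule riesz_fun_span[OF B \<open>finite I\<close>])
    show "linear_on_funs V (?B v)"
      by (rule linear_on_funs_subset[OF semi_innerD(3)[OF semi_inner_L2 v] VL])
    show "?B v u = 0" if "u \<in> V" "?B u u = 0" for u
      using def[OF that] by (simp add: l2_inner_def)
  qed (simp add: V)
  then obtain p where p: "p \<in> V" "\<And>q. q \<in> V \<Longrightarrow> ?B p q = ?B v q"
    by blast
  have "l2_proj \<mu> V v = p"
    unfolding l2_proj_def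
  proof (rule the_equality)
    fix r assume r: "r \<in> V \<and> (\<forall>q\<in>V. ?B r q = ?B v q)"
    have d: "(\<lambda>x. r x - p x) \<in> V"
      by (rule fun_subspaceD(4)[OF sV]) (use r p in auto)
    have "?B (\<lambda>x. r x - p x) (\<lambda>x. r x - p x) = 0"
      using linear_on_funsD(3)[OF semi_innerD(2)[OF B d], of r p] r p d by simp
    from def[OF d this] show "r = p"
      by (simp add: fun_eq_iff)
  qed (use p in blast)
  then show "l2_proj \<mu> V v \<in> V"
    using p(1) by simp
  let ?d = "\<lambda>x. v x - p x"
  have pL: "p \<in> L2 \<mu>"
    using p VL by blast
  have dL: "?d \<in> L2 \<mu>"
    by (rule fun_subspaceD(4)[OF fun_subspace_L2 v pL])
  have "0 \<le> ?B ?d ?d"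
    by (rule semi_innerD(5)[OF semi_inner_L2 dL])
  also have "\<dots> = ?B v ?d - ?B p ?d"
    by (rule linear_on_funsD(3)[OF semi_innerD(2)[OF semi_inner_L2 dL] v pL])
  also have "?B v ?d = ?B v v - ?B v p"
    by (rule linear_on_funsD(3)[OF semi_innerD(3)[OF semi_inner_L2 v] v pL])
  also have "?B p ?d = ?B p v - ?B p p"
    by (rule linear_on_funsD(3)[OF semi_innerD(3)[OF semi_inner_L2 pL] v pL])
  finally show "?B (l2_proj \<mu> V v) (l2_proj \<mu> V v) \<le> ?B v v"
    using p semi_innerD(4)[OF semi_inner_L2 v pL] \<open>l2_proj \<mu> V v = p\<close> by simp
qed

section \<open>Polynomials\<close>

text \<open>Continuous differentiability, phrased through the total function \<open>grad\<close> so
  that its values are known to be true gradients.\<close>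

definition cont_grad :: "scalar \<Rightarrow> bool" where
  "cont_grad p \<longleftrightarrow> continuous_on UNIV (grad p) \<and>
     (\<forall>x. (p has_derivative (\<lambda>v. grad p x \<bullet> v)) (at x))"

lemma grad_eqI:
  assumes "(p has_derivative (\<lambda>v. G \<bullet> v)) (at x)"
  shows "grad p x = G"
  unfolding grad_def frechet_derivative_at[OF assms, symmetric]
  by (simp add: vec_eq_iff inner_axis)

lemma cont_gradI:
  assumes "\<And>x. (p has_derivative (\<lambda>v. G x \<bullet> v)) (at x)" "continuous_on UNIV G"
  shows "cont_grad p" "grad p = G"
proof -
  show "grad p = G"
    using grad_eqI[OF assms(1)] by (rule ext)
  with assms show "cont_grad p"
    by (simp add: cont_grad_def)
qed

lemma cont_gradD:
  assumes "cont_grad p"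
  shows "continuous_on UNIV p" "continuous_on UNIV (grad p)"
    "(p has_derivative (\<lambda>v. grad p x \<bullet> v)) (at x)"
  using assms unfolding cont_grad_def
  by (auto intro!: has_derivative_continuous continuous_at_imp_continuous_on)

lemma cont_grad_const: "cont_grad (\<lambda>_. c)" "grad (\<lambda>_. c) = (\<lambda>_. 0)"
  by (rule cont_gradI[of _ "\<lambda>_. 0"]; simp)+

lemma cont_grad_component: "cont_grad (\<lambda>x. x $ i)"
proof (rule cont_gradI(1))
  show "((\<lambda>x. x $ i) has_derivative (\<lambda>v. axis i 1 \<bullet> v)) (at x)" for x :: pt
    by (auto intro!: derivative_eq_intros bounded_linear_imp_has_derivative bounded_linear_vec_nth
        simp: inner_axis')
qed simp

lemma cont_grad_lincomb:
  assumes "cont_grad p" "cont_grad q"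
  shows "cont_grad (\<lambda>x. a * p x + b * q x)"
    "grad (\<lambda>x. a * p x + b * q x) = (\<lambda>x. a *\<^sub>R grad p x + b *\<^sub>R grad q x)"
proof -
  have "((\<lambda>x. a * p x + b * q x) has_derivative
      (\<lambda>v. (a *\<^sub>R grad p x + b *\<^sub>R grad q x) \<bullet> v)) (at x)" for x
    by (rule has_derivative_eq_rhs[OF has_derivative_add[OF
            has_derivative_mult_right[OF cont_gradD(3)[OF assms(1)]]
            has_derivative_mult_right[OF cont_gradD(3)[OF assms(2)]]]])
      (simp add: inner_add_left)
  moreover have "continuous_on UNIV (\<lambda>x. a *\<^sub>R grad p x + b *\<^sub>R grad q x)"
    using assms by (intro continuous_intros cont_gradD(2))
  ultimately show "cont_grad (\<lambda>x. a * p x + b * q x)"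
    "grad (\<lambda>x. a * p x + b * q x) = (\<lambda>x. a *\<^sub>R grad p x + b *\<^sub>R grad q x)"
    by (rule cont_gradI)+
qed

lemma cont_grad_mult:
  assumes "cont_grad p" "cont_grad q"
  shows "cont_grad (\<lambda>x. p x * q x)"
proof (rule cont_gradI(1))
  show "((\<lambda>x. p x * q x) has_derivative
      (\<lambda>v. (p x *\<^sub>R grad q x + q x *\<^sub>R grad p x) \<bullet> v)) (at x)" for x
    by (rule has_derivative_eq_rhs[OF has_derivative_mult[OF
            cont_gradD(3)[OF assms(1)] cont_gradD(3)[OF assms(2)]]])
      (simp add: inner_add_left mult.commute)
  show "continuous_on UNIV (\<lambda>x. p x *\<^sub>R grad q x + q x *\<^sub>R grad p x)"
    using assms by (intro continuous_intros cont_gradD(1,2))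
qed

lemma cont_grad_power: "cont_grad p \<Longrightarrow> cont_grad (\<lambda>x. p x ^ n)"
  by (induction n) (simp_all add: cont_grad_const cont_grad_mult)

lemma cont_grad_sum: "(\<And>i. i \<in> I \<Longrightarrow> cont_grad (p i)) \<Longrightarrow> cont_grad (\<lambda>x. \<Sum>i\<in>I. p i x)"
  using cont_grad_lincomb(1)[of _ _ 1 1]
  by (induction I rule: infinite_finite_induct) (simp_all add: cont_grad_const)

lemma Pk_cont_grad:
  assumes "p \<in> Pk k"
  shows "cont_grad p"
proof -
  obtain c where c: "p = (\<lambda>x. \<Sum>i\<le>k. \<Sum>j\<le>k - i. c i j * (x$1)^i * (x$2)^j)"
    using assms unfolding Pk_def by blast
  show ?thesis
    unfolding c
    by (intro cont_grad_sum cont_grad_mult cont_grad_power cont_grad_component cont_grad_const)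
qed

definition exponents :: "nat \<Rightarrow> (nat \<times> nat) set" where
  "exponents k = (SIGMA i:{..k}. {..k - i})"

definition mono2 :: "nat \<times> nat \<Rightarrow> scalar" where
  "mono2 = (\<lambda>(i, j) x. (x$1)^i * (x$2)^j)"

lemma finite_exponents: "finite (exponents k)"
  by (simp add: exponents_def)

text \<open>Flattening the double sum into one finite index set brings polynomials into the form
  required by \<open>riesz_fun_span\<close>.\<close>

lemma Pk_eq_fun_span: "Pk k = fun_span (exponents k) mono2"
proof -
  have *: "(\<Sum>i\<le>k. \<Sum>j\<le>k - i. c i j * (x$1)^i * (x$2)^j)
      = (\<Sum>e\<in>exponents k. case_prod c e * mono2 e x)" for c and x :: pt
    unfolding exponents_def by (simp add: sum.Sigma mono2_def split_beta mult.assoc)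
  have "p \<in> Pk k \<longleftrightarrow> p \<in> fun_span (exponents k) mono2" for p
  proof
    assume "p \<in> Pk k"
    then obtain c where "p = (\<lambda>x. \<Sum>e\<in>exponents k. case_prod c e * mono2 e x)"
      unfolding Pk_def by (auto simp: *)
    then show "p \<in> fun_span (exponents k) mono2"
      unfolding fun_span_def by (intro range_eqI[of _ _ "case_prod c"])
  next
    assume "p \<in> fun_span (exponents k) mono2"
    then obtain c where "p = (\<lambda>x. \<Sum>e\<in>exponents k. c e * mono2 e x)"
      unfolding fun_span_def by blast
    then have "p = (\<lambda>x. \<Sum>i\<le>k. \<Sum>j\<le>k - i. curry c i j * (x$1)^i * (x$2)^j)"
      unfolding * by simp
    then show "p \<in> Pk k"
      unfolding Pk_def by blast
  qed
  then show ?thesis by blast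
qed

lemma fun_subspace_Pk: "fun_subspace (Pk k)"
  unfolding Pk_eq_fun_span by (rule fun_subspace_fun_span)

lemma Pk_const: "(\<lambda>_. c) \<in> Pk k"
proof -
  have "mono2 (0, 0) \<in> Pk k"
    unfolding Pk_eq_fun_span by (rule fun_span_base) (simp_all add: exponents_def)
  from fun_subspaceD(5)[OF fun_subspace_Pk this, of c] show ?thesis
    by (simp add: mono2_def)
qed

lemma Pk_on_line:
  assumes "p \<in> Pk k"
  shows "\<exists>P. \<forall>t. p (x + t *\<^sub>R v) = poly P t"
proof -
  obtain c where c: "p = (\<lambda>x. \<Sum>i\<le>k. \<Sum>j\<le>k - i. c i j * (x$1)^i * (x$2)^j)"
    using assms unfolding Pk_def by blast
  show ?thesis
    unfolding c
    by (rule exI[of _ "\<Sum>i\<le>k. \<Sum>j\<le>k - i. [:c i j:] * [:x$1, v$1:]^i * [:x$2, v$2:]^j"])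
      (simp add: poly_sum mult.assoc)
qed

text \<open>Unique continuation: on the line from a point of \<open>U\<close> to an arbitrary
  \<open>y\<close>, the restriction is a one-variable polynomial that vanishes on a neighbourhood of
  0, hence has infinitely many roots.\<close>

lemma Pk_zero_on_open:
  assumes p: "p \<in> Pk k" and U: "open U" "U \<noteq> {}" "\<And>x. x \<in> U \<Longrightarrow> p x = 0"
  shows "p = (\<lambda>_. 0)"
proof
  fix y
  obtain x where x: "x \<in> U"
    using U(2) by blast
  obtain P where P: "\<And>t. p (x + t *\<^sub>R (y - x)) = poly P t"
    using Pk_on_line[OF p] by metis
  have "open ((\<lambda>t. x + t *\<^sub>R (y - x)) -` U)"
    by (intro open_vimage U continuous_intros)
  moreover have "0 \<in> (\<lambda>t. x + t *\<^sub>R (y - x)) -` U"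
    using x by simp
  ultimately have "infinite ((\<lambda>t. x + t *\<^sub>R (y - x)) -` U)"
    using finite_imp_not_open by blast
  then have "infinite {t. poly P t = 0}"
    by (rule infinite_super[rotated]) (auto simp: P[symmetric] U(3))
  then have "P = 0"
    using poly_roots_finite by blast
  then show "p y = 0"
    using P[of 1] by simp
qed

lemma Pk_face_eq_fun_span:
  "Pk_face k F = fun_span (exponents k) (\<lambda>e x. if x \<in> F then mono2 e x else 0)"
proof -
  have "(\<lambda>x. if x \<in> F then \<Sum>e\<in>I. c e * mono2 e x else 0)
      = (\<lambda>x. \<Sum>e\<in>I. c e * (if x \<in> F then mono2 e x else 0))" for c I
    by (auto simp: fun_eq_iff)
  then show ?thesis
    unfolding Pk_face_def Pk_eq_fun_span fun_span_def by (auto simp: image_iff)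
qed

lemma fun_subspace_Pk_face: "fun_subspace (Pk_face k F)"
  unfolding Pk_face_eq_fun_span by (rule fun_subspace_fun_span)

section \<open>Cells and faces\<close>

text \<open>Compactness makes continuous functions integrable, the interior starts unique
  continuation, and the null frontier allows passing between a cell and its interior.\<close>

definition good_cell :: "pt set \<Rightarrow> bool" where
  "good_cell K \<longleftrightarrow> compact K \<and> interior K \<noteq> {} \<and> negligible (frontier K)"

text \<open>Three affinely independent points in the plane span a triangle with interior. The
  frontier of a finite union lies in the union of the frontiers, each null by convexity.\<close>

lemma polygonal_region_good_cell:
  assumes "polygonal_region K"
  shows "good_cell K"
proof -
  obtain \<T> where T: "finite \<T>" "\<T> \<noteq> {}" "\<And>S. S \<in> \<T> \<Longrightarrow> 2 simplex S" "K = \<Union>\<T>"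
    using assms unfolding polygonal_region_def by blast
  have S: "compact S \<and> convex S \<and> interior S \<noteq> {}" if ST: "S \<in> \<T>" for S
  proof -
    obtain C where C: "\<not> affine_dependent C" "int (card C) = 2 + 1" "S = convex hull C"
      using T(3)[OF ST] unfolding simplex_def by blast
    then have "card C = Suc (DIM(pt))" "finite C"
      by (auto simp: aff_independent_finite)
    then show ?thesis
      using C interior_convex_hull_eq_empty[of C]
      by (simp add: finite_imp_compact_convex_hull)
  qed
  have "compact K"
    unfolding T(4) using T(1) S by (intro compact_Union) auto
  moreover have "interior K \<noteq> {}"
  proof -
    obtain S where "S \<in> \<T>"
      using T(2) by blast
    then show ?thesis
      using S[of S] interior_mono[of S K] T(4) by blast
  qed
  moreover have "negligible (frontier K)"
  proof (rule negligible_subset)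
    show "frontier K \<subseteq> (\<Union>S\<in>\<T>. frontier S)"
      unfolding T(4) by (rule frontier_Union_subset[OF T(1)])
    show "negligible (\<Union>S\<in>\<T>. frontier S)"
      using T(1) S by (intro negligible_Union) (auto intro: negligible_convex_frontier)
  qed
  ultimately show ?thesis
    by (simp add: good_cell_def)
qed

lemma integrable_lebesgue_on_compact:
  fixes f :: "'a::euclidean_space \<Rightarrow> 'b::euclidean_space"
  assumes "compact K" "continuous_on K f"
  shows "integrable (lebesgue_on K) f"
proof -
  have "integrable lebesgue (\<lambda>x. indicator K x *\<^sub>R f x)"
    using borel_integrable_compact[OF assms] by (subst integrable_completion) auto
  then show ?thesis
    using assms(1) by (subst integrable_restrict_space) (auto simp: compact_imp_closed)
qed

lemma continuous_L2_compact:
  assumes "compact K" "continuous_on K u"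
  shows "u \<in> L2 (lebesgue_on K)"
  unfolding L2_def
  using integrable_lebesgue_on_compact[OF assms]
    integrable_lebesgue_on_compact[OF assms(1), of "\<lambda>x. (u x)\<^sup>2"] assms(2)
  by (auto intro: continuous_intros)

text \<open>The zero set of \<open>f\<close> is closed and contains almost every point of the open
  interior, hence all of it.\<close>

lemma continuous_integral_zero:
  fixes f :: "pt \<Rightarrow> real"
  assumes K: "compact K" and f: "continuous_on UNIV f" "\<And>x. 0 \<le> f x"
    and "(\<integral>x. f x \<partial>lebesgue_on K) = 0" and x: "x \<in> interior K"
  shows "f x = 0"
proof -
  have "integrable (lebesgue_on K) f"
    using K f(1) by (intro integrable_lebesgue_on_compact) (auto intro: continuous_on_subset)
  with assms have "AE x in lebesgue_on K. f x = 0"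
    by (subst (asm) integral_nonneg_eq_0_iff_AE) auto
  then have "AE x in lebesgue. x \<in> K \<longrightarrow> f x = 0"
    using K by (subst (asm) AE_restrict_space_iff) (auto simp: compact_imp_closed)
  then have "AE x in lebesgue. x \<in> interior K \<longrightarrow> x \<in> {x. f x = 0}"
    by eventually_elim (use interior_subset in auto)
  moreover have "closed {x. f x = 0}"
    using f(1) by (intro closed_Collect_eq) auto
  ultimately show ?thesis
    using mem_closed_if_AE_lebesgue_open[OF open_interior _ _ x] by blast
qed

lemma Pk_L2_cell: "good_cell K \<Longrightarrow> p \<in> Pk k \<Longrightarrow> p \<in> L2 (lebesgue_on K)"
  by (intro continuous_L2_compact)
    (auto simp: good_cell_def intro: continuous_on_subset[OF cont_gradD(1)[OF Pk_cont_grad]])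

lemma Pk_definite:
  assumes "good_cell K" "p \<in> Pk k" "l2_inner (lebesgue_on K) p p = 0"
  shows "p = (\<lambda>_. 0)"
proof (rule Pk_zero_on_open[OF assms(2) open_interior])
  show "interior K \<noteq> {}"
    using assms(1) by (simp add: good_cell_def)
  show "p x = 0" if "x \<in> interior K" for x
    using continuous_integral_zero[of K "\<lambda>x. p x * p x" x] that assms
      cont_gradD(1)[OF Pk_cont_grad[OF assms(2)]]
    by (auto simp: good_cell_def l2_inner_def intro!: continuous_intros)
qed

lemma
  assumes "good_cell K" "v \<in> L2 (lebesgue_on K)"
  shows proj_cell_in: "proj_cell k K v \<in> Pk k"
    and proj_cell_le: "l2_inner (lebesgue_on K) (proj_cell k K v) (proj_cell k K v)
      \<le> l2_inner (lebesgue_on K) v v"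
  unfolding proj_cell_def
  using l2_proj_in[OF Pk_eq_fun_span finite_exponents _ _ assms(2)]
    l2_proj_le[OF Pk_eq_fun_span finite_exponents _ _ assms(2)]
    Pk_L2_cell[OF assms(1)] Pk_definite[OF assms(1)] by blast+

section \<open>Arc-length integration on faces\<close>

definition segment_face :: "pt set \<Rightarrow> bool" where
  "segment_face F \<longleftrightarrow> (\<exists>a b. a \<noteq> b \<and> F = closed_segment a b)"

text \<open>The endpoints obtained are those picked by \<open>SOME\<close> inside
  \<open>arc_measure\<close>, not necessarily the ones witnessing \<open>segment_face\<close>. They
  are distinct since otherwise the segment would be a single point.\<close>

lemma arc_measure_eq:
  assumes "segment_face F"
  obtains a b \<gamma> where "a \<noteq> b" "\<gamma> = (\<lambda>s. a + (s / dist a b) *\<^sub>R (b - a))"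
    "\<gamma> ` {0..dist a b} = F"
    "arc_measure F = distr (lebesgue_on {0..dist a b}) borel \<gamma>"
proof -
  define e where "e = (SOME e. F = closed_segment (fst e) (snd e))"
  obtain a b where ab: "a \<noteq> b" "F = closed_segment a b"
    using assms unfolding segment_face_def by blast
  have F: "F = closed_segment (fst e) (snd e)"
    unfolding e_def by (rule someI[of _ "(a, b)"]) (simp add: ab)
  have ne: "fst e \<noteq> snd e"
  proof
    assume "fst e = snd e"
    then have eq: "closed_segment a b = {fst e}"
      using F ab(2) by simp
    have "a \<in> closed_segment a b" "b \<in> closed_segment a b"
      by simp_all
    then show False
      using ab(1) unfolding eq by simp
  qed
  define \<gamma> where "\<gamma> = (\<lambda>s. fst e + (s / dist (fst e) (snd e)) *\<^sub>R (snd e - fst e))"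
  show thesis
  proof (rule that[OF ne \<gamma>_def])
    show "arc_measure F = distr (lebesgue_on {0..dist (fst e) (snd e)}) borel \<gamma>"
      unfolding arc_measure_def e_def[symmetric] \<gamma>_def by (simp add: Let_def split_beta)
    have L: "dist (fst e) (snd e) > 0"
      using ne by simp
    have "\<gamma> ` {0..dist (fst e) (snd e)} = (\<lambda>u. fst e + u *\<^sub>R (snd e - fst e)) ` {0..1}"
    proof (intro set_eqI iffI)
      fix x assume "x \<in> \<gamma> ` {0..dist (fst e) (snd e)}"
      then obtain s where "s \<in> {0..dist (fst e) (snd e)}" "x = \<gamma> s" by blast
      then show "x \<in> (\<lambda>u. fst e + u *\<^sub>R (snd e - fst e)) ` {0..1}"
        using L by (intro image_eqI[of _ _ "s / dist (fst e) (snd e)"]) (auto simp: \<gamma>_def)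
    next
      fix x assume "x \<in> (\<lambda>u. fst e + u *\<^sub>R (snd e - fst e)) ` {0..1}"
      then obtain u where "u \<in> {0..1}" "x = fst e + u *\<^sub>R (snd e - fst e)" by blast
      then show "x \<in> \<gamma> ` {0..dist (fst e) (snd e)}"
        using L by (intro image_eqI[of _ _ "u * dist (fst e) (snd e)"])
          (auto simp: \<gamma>_def mult_left_le_one_le)
    qed
    then show "\<gamma> ` {0..dist (fst e) (snd e)} = F"
      unfolding F closed_segment_image_interval
      by (simp add: algebra_simps)
  qed
qed

text \<open>Both claims are pulled back along \<open>\<gamma>\<close> to a compact interval of
  positive length, where a continuous nonnegative function with zero integral vanishes identically.
  Measurability refers to the plane since the measure is an image on \<open>borel\<close>;
  continuity is asked only on \<open>F\<close>, to admit extensions by zero.\<close>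

lemma integral_arc:
  assumes F: "segment_face F" and u: "u \<in> borel_measurable borel" "continuous_on F u"
  shows "integrable (arc_measure F) u"
    and "(\<And>x. x \<in> F \<Longrightarrow> 0 \<le> u x) \<Longrightarrow> (\<integral>x. u x \<partial>arc_measure F) = (0::real) \<Longrightarrow>
      x \<in> F \<Longrightarrow> u x = 0"
proof -
  obtain a b \<gamma> where ab: "a \<noteq> b" and g: "\<gamma> = (\<lambda>s. a + (s / dist a b) *\<^sub>R (b - a))"
    and img: "\<gamma> ` {0..dist a b} = F"
    and arc: "arc_measure F = distr (lebesgue_on {0..dist a b}) borel \<gamma>"
    using arc_measure_eq[OF F] by blast
  have cg: "continuous_on A \<gamma>" for A
    unfolding g by (intro continuous_intros) (use ab in auto)
  have mg: "\<gamma> \<in> measurable (lebesgue_on {0..dist a b}) borel"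
    by (intro continuous_imp_measurable_on_sets_lebesgue cg) simp
  have cu: "continuous_on {0..dist a b} (\<lambda>s. u (\<gamma> s))"
    by (rule continuous_on_compose2[OF u(2) cg]) (simp add: img)
  have i: "integrable (lebesgue_on {0..dist a b}) (\<lambda>s. u (\<gamma> s))"
    by (rule continuous_imp_integrable_real[OF cu])
  then show "integrable (arc_measure F) u"
    unfolding arc by (subst integrable_distr_eq[OF mg u(1)])
  assume nn: "\<And>x. x \<in> F \<Longrightarrow> 0 \<le> u x" and 0: "(\<integral>x. u x \<partial>arc_measure F) = 0" and x: "x \<in> F"
  have "integral {0..dist a b} (\<lambda>s. u (\<gamma> s)) = 0"
    using 0 unfolding arc integral_distr[OF mg u(1)]
    by (subst (asm) lebesgue_integral_eq_integral[OF i]) auto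
  moreover have "0 \<le> u (\<gamma> s)" if "s \<in> {0..dist a b}" for s
    using nn img that by blast
  moreover have "0 < dist a b"
    using ab by simp
  ultimately have "\<forall>s\<in>{0..dist a b}. u (\<gamma> s) = 0"
    using integral_eq_0_iff[OF cu] by blast
  then show "u x = 0"
    using x unfolding img[symmetric] by blast
qed

text \<open>Contains both the extensions by zero of face polynomials and the cell polynomials.\<close>

definition arc_funs :: "pt set \<Rightarrow> scalar set" where
  "arc_funs F = {u \<in> borel_measurable borel. continuous_on F u}"

lemma arc_funs_L2:
  assumes F: "segment_face F" and u: "u \<in> arc_funs F"
  shows "u \<in> L2 (arc_measure F)"
proof -
  have m: "u \<in> borel_measurable borel" and c: "continuous_on F u"
    using u by (simp_all add: arc_funs_def)
  have "integrable (arc_measure F) (\<lambda>x. (u x)\<^sup>2)"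
    by (rule integral_arc(1)[OF F]) (use m c in \<open>simp_all add: continuous_on_power\<close>)
  moreover have "u \<in> borel_measurable (arc_measure F)"
    using integral_arc(1)[OF F m c] by (rule borel_measurable_integrable)
  ultimately show ?thesis
    by (simp add: L2_def)
qed

lemma arc_funs_diff: "u \<in> arc_funs F \<Longrightarrow> v \<in> arc_funs F \<Longrightarrow> (\<lambda>x. u x - v x) \<in> arc_funs F"
  by (simp add: arc_funs_def continuous_on_diff borel_measurable_diff)

lemma continuous_arc_funs: "continuous_on UNIV u \<Longrightarrow> u \<in> arc_funs F"
  by (simp add: arc_funs_def borel_measurable_continuous_onI continuous_on_subset[of UNIV])

lemma Pk_face_arc_funs:
  assumes F: "segment_face F" and p: "p \<in> Pk_face k F"
  shows "p \<in> arc_funs F"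
proof -
  obtain q where q: "q \<in> Pk k" "p = (\<lambda>x. if x \<in> F then q x else 0)"
    using p unfolding Pk_face_def by blast
  have c: "continuous_on UNIV q"
    by (rule cont_gradD(1)[OF Pk_cont_grad[OF q(1)]])
  have "F \<in> sets borel"
    using F unfolding segment_face_def by (metis borel_closed closed_segment)
  then have "p \<in> borel_measurable borel"
    unfolding q(2) using borel_measurable_continuous_onI[OF c]
    by (intro measurable_If_set) simp_all
  moreover have "continuous_on F p"
    by (rule continuous_on_eq[OF continuous_on_subset[OF c]]) (simp_all add: q(2))
  ultimately show ?thesis
    by (simp add: arc_funs_def)
qed

text \<open>Definiteness has two sources: on \<open>F\<close> a null face polynomial vanishes by
  continuity, and off \<open>F\<close> by the convention of extension by zero.\<close>

lemma proj_face_in: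
  assumes F: "segment_face F" and v: "v \<in> L2 (arc_measure F)"
  shows "proj_face k F v \<in> Pk_face k F"
  unfolding proj_face_def
proof (rule l2_proj_in[OF Pk_face_eq_fun_span finite_exponents _ _ v])
  show "Pk_face k F \<subseteq> L2 (arc_measure F)"
    using arc_funs_L2[OF F] Pk_face_arc_funs[OF F] by blast
  fix u assume u: "u \<in> Pk_face k F" "l2_inner (arc_measure F) u u = 0"
  have "u \<in> arc_funs F"
    by (rule Pk_face_arc_funs[OF F u(1)])
  then have "(\<lambda>x. u x * u x) \<in> borel_measurable borel" "continuous_on F (\<lambda>x. u x * u x)"
    by (simp_all add: arc_funs_def continuous_on_mult borel_measurable_times)
  then have "u x * u x = 0" if "x \<in> F" for x
    using integral_arc(2)[OF F, of "\<lambda>x. u x * u x" x] u(2) that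
    by (auto simp: l2_inner_def)
  moreover have "u x = 0" if "x \<notin> F" for x
    using u(1) that by (auto simp: Pk_face_def)
  ultimately show "u = (\<lambda>_. 0)"
    by (auto simp: fun_eq_iff)
qed

section \<open>The reconstruction is a polynomial\<close>

lemma integrable_grad_inner:
  assumes "good_cell K" "cont_grad u" "cont_grad w"
  shows "integrable (lebesgue_on K) (\<lambda>x. grad u x \<bullet> grad w x)"
  using assms(1) cont_gradD(2)[OF assms(2)] cont_gradD(2)[OF assms(3)]
  by (intro integrable_lebesgue_on_compact continuous_on_inner)
    (auto simp: good_cell_def intro: continuous_on_subset)

lemma linear_grad_inner:
  assumes "good_cell K" "cont_grad w"
  shows "linear_on_funs (Pk k) (\<lambda>u. \<integral>x. grad u x \<bullet> grad w x \<partial>lebesgue_on K)"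
  unfolding linear_on_funs_def
proof (intro ballI allI)
  fix u v a b assume "u \<in> Pk k" "v \<in> Pk k"
  then have uv: "cont_grad u" "cont_grad v"
    by (simp_all add: Pk_cont_grad)
  show "(\<integral>x. grad (\<lambda>x. a * u x + b * v x) x \<bullet> grad w x \<partial>lebesgue_on K) =
      a * (\<integral>x. grad u x \<bullet> grad w x \<partial>lebesgue_on K) + b * (\<integral>x. grad v x \<bullet> grad w x \<partial>lebesgue_on K)"
    unfolding cont_grad_lincomb(2)[OF uv] inner_add_left inner_scaleR_left
    using integrable_grad_inner[OF assms(1) uv(1) assms(2)]
      integrable_grad_inner[OF assms(1) uv(2) assms(2)]
    by (subst Bochner_Integration.integral_add) simp_all
qed

lemma semi_inner_grad:
  assumes "good_cell K"
  shows "semi_inner (Pk k) (\<lambda>u w. \<integral>x. grad u x \<bullet> grad w x \<partial>lebesgue_on K)"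
  unfolding semi_inner_def
  using linear_grad_inner[OF assms Pk_cont_grad] fun_subspace_Pk
  by (simp add: inner_commute)

text \<open>Vanishing gradient gives constancy only on a connected set, and the interior of a cell
  may be disconnected. So a single ball is used, and unique continuation spreads the constant to the
  plane.\<close>

lemma grad_null_const:
  assumes K: "good_cell K" and u: "u \<in> Pk k"
    and 0: "(\<integral>x. grad u x \<bullet> grad u x \<partial>lebesgue_on K) = 0"
  shows "\<exists>c. u = (\<lambda>_. c)"
proof -
  obtain x0 e where e: "0 < e" "ball x0 e \<subseteq> interior K"
    using K open_interior[of K] unfolding good_cell_def open_contains_ball by blast
  note g = Pk_cont_grad[OF u]
  have g0: "grad u x = 0" if "x \<in> interior K" for x
    using continuous_integral_zero[OF _ _ _ 0 that] K cont_gradD(2)[OF g]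
    by (simp add: good_cell_def continuous_on_inner)
  then have "(u has_derivative (\<lambda>_. 0)) (at x within ball x0 e)" if "x \<in> ball x0 e" for x
  proof -
    have "(\<bullet>) (grad u x) = (\<lambda>_. 0)"
      using g0 e(2) that by (auto simp: fun_eq_iff)
    with has_derivative_at_withinI[OF cont_gradD(3)[OF g, of x]] show ?thesis
      by metis
  qed
  then have "\<exists>c. \<forall>x\<in>ball x0 e. u x = c"
    by (intro has_derivative_zero_constant) simp_all
  then obtain c where c: "\<And>x. x \<in> ball x0 e \<Longrightarrow> u x = c"
    by blast
  have "(\<lambda>x. u x - c) = (\<lambda>_. 0)"
    by (rule Pk_zero_on_open[OF fun_subspaceD(4)[OF fun_subspace_Pk u Pk_const] open_ball[of x0 e]])
      (use c e(1) in simp_all)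
  then show ?thesis
    by (intro exI[of _ c]) (simp add: fun_eq_iff)
qed

text \<open>A discrete Neumann problem: the gradient form has the constants as kernel and the
  right-hand side vanishes there, so a solution exists and is unique up to a constant, which the
  mean value condition fixes. Only then does \<open>THE\<close> yield a polynomial.\<close>

lemma reconstruction_in:
  assumes K: "good_cell K" and F: "\<And>F. F \<in> cell_faces \<F> K \<Longrightarrow> segment_face F"
    and q: "fst q K \<in> Pk k" "\<And>F. F \<in> cell_faces \<F> K \<Longrightarrow> snd q F \<in> Pk_face k F"
  shows "reconstruction k \<F> K q \<in> Pk (k + 1)"
proof -
  let ?V = "Pk (k + 1)" and ?I = "l2_inner (lebesgue_on K)"
  let ?B = "\<lambda>u w. \<integral>x. grad u x \<bullet> grad w x \<partial>lebesgue_on K"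
  define L where "L = (\<lambda>w. (\<integral>x. grad (fst q K) x \<bullet> grad w x \<partial>lebesgue_on K) +
        (\<Sum>F\<in>cell_faces \<F> K.
           l2_inner (arc_measure F) (\<lambda>x. snd q F x - fst q K x) (\<lambda>x. normal K F \<bullet> grad w x)))"
  note B = semi_inner_grad[OF K, of "k + 1"]
  have arc: "(\<lambda>x. n \<bullet> grad w x) \<in> L2 (arc_measure F)"
    if "F \<in> cell_faces \<F> K" "cont_grad w" for F n w
    by (rule arc_funs_L2[OF F[OF that(1)] continuous_arc_funs])
      (use cont_gradD(2)[OF that(2)] in \<open>intro continuous_intros\<close>)
  have "linear_on_funs ?V L"
    unfolding L_def
  proof (intro linear_on_funs_add linear_on_funs_sum)
    show "linear_on_funs ?V (\<lambda>w. \<integral>x. grad (fst q K) x \<bullet> grad w x \<partial>lebesgue_on K)"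
      using linear_grad_inner[OF K Pk_cont_grad[OF q(1)]] by (simp add: inner_commute)
  next
    fix F assume FK: "F \<in> cell_faces \<F> K"
    let ?u = "\<lambda>x. snd q F x - fst q K x"
    have u: "?u \<in> L2 (arc_measure F)"
      by (intro arc_funs_L2[OF F[OF FK]] arc_funs_diff Pk_face_arc_funs[OF F[OF FK] q(2)[OF FK]]
          continuous_arc_funs cont_gradD(1)[OF Pk_cont_grad[OF q(1)]])
    show "linear_on_funs ?V
        (\<lambda>w. l2_inner (arc_measure F) ?u (\<lambda>x. normal K F \<bullet> grad w x))"
      unfolding linear_on_funs_def
    proof (intro ballI allI)
      fix v w a b assume "v \<in> ?V" "w \<in> ?V"
      then have vw: "cont_grad v" "cont_grad w"
        by (simp_all only: Pk_cont_grad)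
      show "l2_inner (arc_measure F) ?u (\<lambda>x. normal K F \<bullet> grad (\<lambda>x. a * v x + b * w x) x) =
          a * l2_inner (arc_measure F) ?u (\<lambda>x. normal K F \<bullet> grad v x) +
          b * l2_inner (arc_measure F) ?u (\<lambda>x. normal K F \<bullet> grad w x)"
        unfolding cont_grad_lincomb(2)[OF vw] inner_add_right inner_scaleR_right
        by (rule linear_on_funsD(1)[OF semi_innerD(3)[OF semi_inner_L2 u] arc[OF FK vw(1)] arc[OF FK vw(2)]])
    qed
  qed
  \<comment> \<open>Compatibility of the Neumann problem: null vectors are constants, and
    \<open>L\<close> sees its argument only through the gradient.\<close>
  moreover have "L u = 0" if u: "u \<in> ?V" "?B u u = 0" for u
  proof -
    obtain c where "u = (\<lambda>_. c)"
      using grad_null_const[OF K u] by blast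
    then show ?thesis
      by (simp add: L_def cont_grad_const l2_inner_def)
  qed
  ultimately obtain p where p: "p \<in> ?V" "\<And>w. w \<in> ?V \<Longrightarrow> ?B p w = L w"
    using riesz_fun_span[OF B finite_exponents, of "k + 1" mono2 L]
    unfolding Pk_eq_fun_span[symmetric] by blast
  have one: "(\<lambda>_. 1) \<in> ?V"
    by (rule Pk_const)
  have onenz: "?I (\<lambda>_. 1) (\<lambda>_. 1) \<noteq> 0"
    using Pk_definite[OF K one] by (auto simp: fun_eq_iff)
  note lin = linear_on_funsD[OF semi_innerD(2)[OF semi_inner_L2 Pk_L2_cell[OF K one]]
      Pk_L2_cell[OF K] Pk_L2_cell[OF K]]
  \<comment> \<open>The additive constant that corrects the mean of \<open>p\<close>; the
    denominator is the area of the cell.\<close>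
  define c where "c = (?I (fst q K) (\<lambda>_. 1) - ?I p (\<lambda>_. 1)) / ?I (\<lambda>_. 1) (\<lambda>_. 1)"
  have "\<exists>!r. r \<in> ?V \<and> (\<forall>w\<in>?V. ?B r w = L w) \<and> ?I r (\<lambda>_. 1) = ?I (fst q K) (\<lambda>_. 1)"
  proof (rule ex_ex1I)
    let ?r = "\<lambda>x. 1 * p x + c * 1"
    have "?r \<in> ?V"
      by (rule fun_subspaceD(2)[OF fun_subspace_Pk p(1) one])
    moreover have "grad ?r = grad p"
      using cont_grad_lincomb(2)[OF Pk_cont_grad[OF p(1)] Pk_cont_grad[OF one], of 1 c]
      by (simp add: cont_grad_const)
    moreover have "?I ?r (\<lambda>_. 1) = ?I (fst q K) (\<lambda>_. 1)"
      using lin(1)[OF p(1) one, of 1 c] onenz by (simp add: c_def)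
    ultimately show "\<exists>r. r \<in> ?V \<and> (\<forall>w\<in>?V. ?B r w = L w) \<and> ?I r (\<lambda>_. 1) = ?I (fst q K) (\<lambda>_. 1)"
      using p(2) by (intro exI[of _ ?r]) simp
  next
    fix r s
    assume r: "r \<in> ?V \<and> (\<forall>w\<in>?V. ?B r w = L w) \<and> ?I r (\<lambda>_. 1) = ?I (fst q K) (\<lambda>_. 1)"
      and s: "s \<in> ?V \<and> (\<forall>w\<in>?V. ?B s w = L w) \<and> ?I s (\<lambda>_. 1) = ?I (fst q K) (\<lambda>_. 1)"
    let ?d = "\<lambda>x. r x - s x"
    have d: "?d \<in> ?V"
      by (rule fun_subspaceD(4)[OF fun_subspace_Pk]) (use r s in auto)
    have "?B ?d ?d = 0"
      using linear_on_funsD(3)[OF semi_innerD(2)[OF B d], of r s] r s d by simp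
    then obtain c where c: "?d = (\<lambda>_. c)"
      using grad_null_const[OF K d] by blast
    have "?I ?d (\<lambda>_. 1) = 0"
      using lin(3)[of r "k + 1" s "k + 1"] r s by simp
    moreover have "?I ?d (\<lambda>_. 1) = c * ?I (\<lambda>_. 1) (\<lambda>_. 1)"
      unfolding c using lin(4)[OF one one, of c] by simp
    ultimately have "c = 0"
      using onenz by simp
    with c show "r = s"
      by (simp add: fun_eq_iff)
  qed
  from theI'[OF this] show ?thesis
    unfolding reconstruction_def L_def by (rule conjunct1)
qed

section \<open>Positivity of the bilinear form\<close>

text \<open>Positivity of a kernel only involves values on pairs, so it can be obtained from a Gram
  representation without knowing that the kernel is bilinear.\<close>

definition pos_kernel :: "'a set \<Rightarrow> ('a \<Rightarrow> 'a \<Rightarrow> real) \<Rightarrow> bool" where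
  "pos_kernel S b \<longleftrightarrow>
     (\<forall>n Q. (\<forall>i<n. Q i \<in> S) \<longrightarrow> 0 \<le> (\<Sum>i<(n::nat). \<Sum>j<n. b (Q i) (Q j)))"

lemma pos_kernel_add:
  "pos_kernel S b \<Longrightarrow> pos_kernel S b' \<Longrightarrow> pos_kernel S (\<lambda>q r. b q r + b' q r)"
  unfolding pos_kernel_def by (simp add: sum.distrib)

lemma pos_kernel_sum:
  assumes "\<And>i. i \<in> I \<Longrightarrow> pos_kernel S (b i)"
  shows "pos_kernel S (\<lambda>q r. \<Sum>i\<in>I. b i q r)"
  using assms
proof (induction I rule: infinite_finite_induct)
  case (insert i I)
  then show ?case
    using pos_kernel_add[of S "b i" "\<lambda>q r. \<Sum>i\<in>I. b i q r"] by simp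
qed (simp_all add: pos_kernel_def)

lemma pos_kernel_scale: "0 \<le> c \<Longrightarrow> pos_kernel S b \<Longrightarrow> pos_kernel S (\<lambda>q r. c * b q r)"
  unfolding pos_kernel_def by (simp add: sum_distrib_left[symmetric])

text \<open>By integrability the double sum becomes one integral, of the squared norm of the sum of
  the \<open>\<phi> (Q i)\<close>.\<close>

lemma pos_kernel_integral:
  fixes \<phi> :: "'a \<Rightarrow> 'x \<Rightarrow> 'b::real_inner"
  assumes "\<And>q r. q \<in> S \<Longrightarrow> r \<in> S \<Longrightarrow> integrable \<mu> (\<lambda>x. \<phi> q x \<bullet> \<phi> r x)"
  shows "pos_kernel S (\<lambda>q r. \<integral>x. \<phi> q x \<bullet> \<phi> r x \<partial>\<mu>)"
  unfolding pos_kernel_def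
proof (intro allI impI)
  fix n :: nat and Q assume Q: "\<forall>i<n. Q i \<in> S"
  have "(\<Sum>i<n. \<Sum>j<n. \<integral>x. \<phi> (Q i) x \<bullet> \<phi> (Q j) x \<partial>\<mu>)
      = (\<Sum>i<n. \<integral>x. (\<Sum>j<n. \<phi> (Q i) x \<bullet> \<phi> (Q j) x) \<partial>\<mu>)"
    by (intro sum.cong refl, subst Bochner_Integration.integral_sum) (use Q assms in auto)
  also have "\<dots> = (\<integral>x. (\<Sum>i<n. \<Sum>j<n. \<phi> (Q i) x \<bullet> \<phi> (Q j) x) \<partial>\<mu>)"
    by (subst Bochner_Integration.integral_sum)
      (use Q assms in \<open>auto intro!: Bochner_Integration.integrable_sum\<close>)
  also have "\<dots> = (\<integral>x. (\<Sum>i<n. \<phi> (Q i) x) \<bullet> (\<Sum>i<n. \<phi> (Q i) x) \<partial>\<mu>)"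
    by (simp only: inner_sum_left) (simp only: inner_sum_right)
  also have "\<dots> \<ge> 0"
    by (rule Bochner_Integration.integral_nonneg) simp
  finally show "0 \<le> (\<Sum>i<n. \<Sum>j<n. \<integral>x. \<phi> (Q i) x \<bullet> \<phi> (Q j) x \<partial>\<mu>)" .
qed

lemma mesh_good_cell:
  assumes "polygonal_mesh \<Omega> \<K> \<F>" "K \<in> \<K>"
  shows "good_cell K"
proof (rule polygonal_region_good_cell)
  show "polygonal_region K"
    using assms by (simp add: polygonal_mesh_def)
qed

lemma mesh_segment_face:
  assumes "polygonal_mesh \<Omega> \<K> \<F>" "F \<in> cell_faces \<F> K"
  shows "segment_face F"
  using assms by (simp add: polygonal_mesh_def segment_face_def cell_faces_def)

lemma VhD:
  assumes "q \<in> Vh k \<K> \<F>"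
  shows "K \<in> \<K> \<Longrightarrow> fst q K \<in> Pk k" "F \<in> cell_faces \<F> K \<Longrightarrow> snd q F \<in> Pk_face k F"
proof -
  have "if K \<in> \<K> then fst q K \<in> Pk k else fst q K = (\<lambda>_. 0)"
    "if F \<in> \<F> then snd q F \<in> Pk_face k F else snd q F = (\<lambda>_. 0)"
    using assms by (simp_all add: Vh_def)
  then show "K \<in> \<K> \<Longrightarrow> fst q K \<in> Pk k" "F \<in> cell_faces \<F> K \<Longrightarrow> snd q F \<in> Pk_face k F"
    by (simp_all add: cell_faces_def)
qed

context
  fixes k :: nat and \<Omega> :: "pt set" and \<K> \<F> :: "pt set set"
  assumes mesh: "polygonal_mesh \<Omega> \<K> \<F>"
begin

lemma mesh_reconstruction_in:
  assumes "q \<in> Vh k \<K> \<F>" "K \<in> \<K>"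
  shows "reconstruction k \<F> K q \<in> Pk (k + 1)"
  using mesh_good_cell[OF mesh assms(2)] mesh_segment_face[OF mesh] VhD(1)[OF assms]
    VhD(2)[OF assms(1)]
  by (intro reconstruction_in) auto

text \<open>Since the reconstruction is a polynomial, both projections act on square integrable
  functions and so land in their polynomial spaces. This makes the products in the stabilization
  integrable on \<open>F\<close>.\<close>

lemma delta_arc_funs:
  assumes q: "q \<in> Vh k \<K> \<F>" and K: "K \<in> \<K>" and F: "F \<in> cell_faces \<F> K"
  shows "(\<lambda>x. delta_face k \<F> K F q x - delta_cell k \<F> K q x) \<in> arc_funs F"
proof (rule arc_funs_diff)
  have R: "continuous_on UNIV (reconstruction k \<F> K q)"
    by (rule cont_gradD(1)[OF Pk_cont_grad[OF mesh_reconstruction_in[OF q K]]])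
  have qK: "continuous_on UNIV (fst q K)"
    by (rule cont_gradD(1)[OF Pk_cont_grad[OF VhD(1)[OF q K]]])
  note gK = mesh_good_cell[OF mesh K] and sF = mesh_segment_face[OF mesh F]
  have "delta_cell k \<F> K q \<in> Pk k"
    unfolding delta_cell_def
  proof (intro proj_cell_in gK continuous_L2_compact)
    show "continuous_on K (\<lambda>x. reconstruction k \<F> K q x - fst q K x)"
      using R qK by (intro continuous_on_diff) (auto intro: continuous_on_subset)
    show "compact K"
      using gK by (simp add: good_cell_def)
  qed
  then show "delta_cell k \<F> K q \<in> arc_funs F"
    by (intro continuous_arc_funs cont_gradD(1) Pk_cont_grad)
  show "delta_face k \<F> K F q \<in> arc_funs F"
    unfolding delta_face_def
    by (rule Pk_face_arc_funs[OF sF proj_face_in[OF sF]], intro arc_funs_L2[OF sF] arc_funs_diff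
        continuous_arc_funs R Pk_face_arc_funs[OF sF VhD(2)[OF q F]])
qed

text \<open>Each cell contributes the Gram kernel of the reconstructed gradients, and each of its
  faces the Gram kernel of the stabilization residuals with a nonnegative weight.\<close>

lemma pos_kernel_bform: "pos_kernel (Vh k \<K> \<F>) (bform k \<K> \<F>)"
  unfolding bform_def[abs_def] stab_def stab_cell_def l2_inner_def
proof (intro pos_kernel_add pos_kernel_sum pos_kernel_scale)
  fix K assume K: "K \<in> \<K>"
  show "pos_kernel (Vh k \<K> \<F>) (\<lambda>q r. \<integral>x. grad (reconstruction k \<F> K q) x \<bullet>
      grad (reconstruction k \<F> K r) x \<partial>lebesgue_on K)"
    by (intro pos_kernel_integral integrable_grad_inner mesh_good_cell[OF mesh K]
        Pk_cont_grad[OF mesh_reconstruction_in[OF _ K]])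
  fix F assume F: "F \<in> cell_faces \<F> K"
  show "0 \<le> inverse (diameter F)"
  proof -
    obtain a b where "F = closed_segment a b"
      using mesh_segment_face[OF mesh F] by (auto simp: segment_face_def)
    then show ?thesis
      by (simp add: diameter_ge_0 bounded_closed_segment)
  qed
  show "pos_kernel (Vh k \<K> \<F>) (\<lambda>q r. \<integral>x. (delta_face k \<F> K F q x - delta_cell k \<F> K q x) *
      (delta_face k \<F> K F r x - delta_cell k \<F> K r x) \<partial>arc_measure F)"
    unfolding inner_real_def[symmetric]
    by (rule pos_kernel_integral, unfold inner_real_def)
      (intro L2_integrable_mult arc_funs_L2[OF mesh_segment_face[OF mesh F]] delta_arc_funs K F)
qed

end

lemma bform_commute: "bform k \<K> \<F> q r = bform k \<K> \<F> r q"
  by (simp add: bform_def stab_def stab_cell_def l2_inner_def inner_commute mult.commute)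

section \<open>Broken functions\<close>

lemma AE_interior_eq:
  assumes "good_cell K"
  shows "AE x in lebesgue. x \<in> K \<longleftrightarrow> x \<in> interior K"
proof -
  have "frontier K \<in> null_sets lebesgue"
    using assms by (simp add: good_cell_def negligible_iff_null_sets)
  then have "AE x in lebesgue. x \<notin> frontier K"
    by (rule AE_not_in)
  then show ?thesis
    by eventually_elim (use assms interior_subset[of K] in
      \<open>auto simp: good_cell_def frontier_def dest: compact_imp_closed\<close>)
qed

lemma cell_sets:
  assumes "good_cell K"
  shows "K \<in> sets lebesgue" "interior K \<in> sets lebesgue"
  using assms by (auto simp: good_cell_def compact_imp_closed)

text \<open>A closed cell may contain boundary points of the open domain, so restriction to the cell
  and to the domain are compared through the interior, which misses only a null set of the
  cell.\<close>

lemma integral_interior: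
  fixes f :: "pt \<Rightarrow> real"
  assumes K: "good_cell K" and O: "\<Omega> \<in> sets lebesgue" "interior K \<subseteq> \<Omega>"
    and f: "integrable (lebesgue_on K) f"
  shows "integrable (lebesgue_on \<Omega>) (\<lambda>x. indicator (interior K) x * f x)"
    and "(\<integral>x. indicator (interior K) x * f x \<partial>lebesgue_on \<Omega>) = (\<integral>x. f x \<partial>lebesgue_on K)"
proof -
  have i: "integrable lebesgue (\<lambda>x. indicator K x *\<^sub>R f x)"
    using f cell_sets[OF K] by (simp add: integrable_restrict_space)
  have "integrable lebesgue (\<lambda>x. indicator (interior K) x *\<^sub>R (indicator K x *\<^sub>R f x))"
    by (rule integrable_mult_indicator[OF cell_sets(2)[OF K] i])
  also have "(\<lambda>x. indicator (interior K) x *\<^sub>R (indicator K x *\<^sub>R f x))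
      = (\<lambda>x. indicator (interior K) x *\<^sub>R f x)"
    using interior_subset[of K] by (auto simp: indicator_def fun_eq_iff)
  finally have j: "integrable lebesgue (\<lambda>x. indicator (interior K) x *\<^sub>R f x)" .
  have O': "\<Omega> \<inter> space lebesgue \<in> sets lebesgue" and K': "K \<inter> space lebesgue \<in> sets lebesgue"
    using O(1) cell_sets(1)[OF K] by simp_all
  have e: "(\<lambda>x. indicator \<Omega> x *\<^sub>R (indicator (interior K) x * f x))
      = (\<lambda>x. indicator (interior K) x *\<^sub>R f x)"
    using O(2) by (auto simp: indicator_def fun_eq_iff)
  show "integrable (lebesgue_on \<Omega>) (\<lambda>x. indicator (interior K) x * f x)"
    unfolding integrable_restrict_space[OF O'] e by (rule j)
  have "(\<integral>x. indicator (interior K) x * f x \<partial>lebesgue_on \<Omega>)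
      = (\<integral>x. indicator (interior K) x *\<^sub>R f x \<partial>lebesgue)"
    unfolding integral_restrict_space[OF O'] e ..
  also have "\<dots> = (\<integral>x. indicator K x *\<^sub>R f x \<partial>lebesgue)"
  proof (rule integral_cong_AE)
    show "AE x in lebesgue. indicator (interior K) x *\<^sub>R f x = indicator K x *\<^sub>R f x"
      using AE_interior_eq[OF K] by eventually_elim (simp add: indicator_def)
  qed (rule borel_measurable_integrable[OF j] borel_measurable_integrable[OF i])+
  also have "\<dots> = (\<integral>x. f x \<partial>lebesgue_on K)"
    by (rule integral_restrict_space[OF K', symmetric])
  finally show "(\<integral>x. indicator (interior K) x * f x \<partial>lebesgue_on \<Omega>) = (\<integral>x. f x \<partial>lebesgue_on K)" .
qed

text \<open>On the part of the cell outside the domain nothing is known about \<open>f\<close>. That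
  part is null, and completeness of Lebesgue measure makes a function measurable if it agrees almost
  everywhere with a measurable one.\<close>

lemma measurable_on_cell:
  fixes f :: "pt \<Rightarrow> real"
  assumes K: "good_cell K" and O: "\<Omega> \<in> sets lebesgue" "interior K \<subseteq> \<Omega>"
    and f: "f \<in> borel_measurable (lebesgue_on \<Omega>)"
  shows "f \<in> borel_measurable (lebesgue_on K)"
proof -
  have O': "\<Omega> \<inter> space lebesgue \<in> sets lebesgue" and K': "K \<inter> space lebesgue \<in> sets lebesgue"
    using O(1) cell_sets(1)[OF K] by simp_all
  let ?f = "\<lambda>x. indicator (interior K) x *\<^sub>R (indicator \<Omega> x *\<^sub>R f x)"
  have "?f \<in> borel_measurable lebesgue"
    by (rule borel_measurable_scaleR[OF borel_measurable_indicator[OF cell_sets(2)[OF K]]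
          f[unfolded borel_measurable_restrict_space_iff[OF O']]])
  moreover have "AE x in lebesgue. ?f x = indicator K x *\<^sub>R f x"
    using AE_interior_eq[OF K] by eventually_elim (use O(2) in \<open>auto simp: indicator_def\<close>)
  ultimately show ?thesis
    unfolding borel_measurable_restrict_space_iff[OF K'] by (rule borel_measurable_AE)
qed

lemma integrable_on_cell:
  fixes f :: "pt \<Rightarrow> real"
  assumes K: "good_cell K" and O: "\<Omega> \<in> sets lebesgue" "interior K \<subseteq> \<Omega>"
    and f: "integrable (lebesgue_on \<Omega>) f"
  shows "integrable (lebesgue_on K) f"
proof -
  have O': "\<Omega> \<inter> space lebesgue \<in> sets lebesgue" and K': "K \<inter> space lebesgue \<in> sets lebesgue"
    using O(1) cell_sets(1)[OF K] by simp_all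
  let ?f = "\<lambda>x. indicator (interior K) x *\<^sub>R (indicator \<Omega> x *\<^sub>R f x)"
  have i: "integrable lebesgue ?f"
    by (rule integrable_mult_indicator[OF cell_sets(2)[OF K]
          f[unfolded integrable_restrict_space[OF O']]])
  have ae: "AE x in lebesgue. ?f x = indicator K x *\<^sub>R f x"
    using AE_interior_eq[OF K] by eventually_elim (use O(2) in \<open>auto simp: indicator_def\<close>)
  have m: "(\<lambda>x. indicator K x *\<^sub>R f x) \<in> borel_measurable lebesgue"
    by (rule borel_measurable_AE[OF borel_measurable_integrable[OF i] ae])
  show ?thesis
    unfolding integrable_restrict_space[OF K']
    by (rule integrable_cong_AE[THEN iffD1, OF borel_measurable_integrable[OF i] m ae i])
qed

lemma L2_on_cell:
  assumes K: "good_cell K" and O: "\<Omega> \<in> sets lebesgue" "interior K \<subseteq> \<Omega>"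
    and u: "u \<in> L2 (lebesgue_on \<Omega>)"
  shows "u \<in> L2 (lebesgue_on K)"
proof -
  have "u \<in> borel_measurable (lebesgue_on \<Omega>)" "integrable (lebesgue_on \<Omega>) (\<lambda>x. (u x)\<^sup>2)"
    using u by (simp_all add: L2_def)
  from measurable_on_cell[OF K O this(1)] integrable_on_cell[OF K O this(2)]
  show ?thesis
    by (simp add: L2_def)
qed

text \<open>Cells lie only in the closure of the domain. As the domain is the interior of a closed
  polytope containing that closure, taking interiors leads back into the domain.\<close>

lemma mesh_domain:
  assumes "convex_polygonal_domain \<Omega>" and mesh: "polygonal_mesh \<Omega> \<K> \<F>"
  shows "\<Omega> \<in> sets lebesgue" "K \<in> \<K> \<Longrightarrow> interior K \<subseteq> \<Omega>" "finite \<K>"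
    "pairwise (\<lambda>K L. interior K \<inter> interior L = {}) \<K>"
proof -
  obtain P where P: "polytope P" "\<Omega> = interior P"
    using assms(1) by (auto simp: convex_polygonal_domain_def)
  show "\<Omega> \<in> sets lebesgue"
    using P(2) by simp
  show "finite \<K>" "pairwise (\<lambda>K L. interior K \<inter> interior L = {}) \<K>"
    using mesh by (simp_all add: polygonal_mesh_def)
  have U: "\<Union>\<K> = closure \<Omega>"
    using mesh by (simp add: polygonal_mesh_def)
  show "interior K \<subseteq> \<Omega>" if "K \<in> \<K>"
  proof -
    have "closure \<Omega> \<subseteq> P"
      unfolding P(2) using P(1) by (intro closure_minimal interior_subset polytope_imp_closed)
    then have "K \<subseteq> P"
      using U that by blast
    then show ?thesis
      unfolding P(2) by (rule interior_mono)
  qed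
qed

lemma disjoint_indicator_sum:
  fixes a :: "pt set \<Rightarrow> real"
  assumes "finite \<K>" "pairwise (\<lambda>K L. interior K \<inter> interior L = {}) \<K>" "K \<in> \<K>" "x \<in> interior K"
  shows "(\<Sum>L\<in>\<K>. indicator (interior L) x * a L) = a K"
proof -
  have "(\<Sum>L\<in>\<K>. indicator (interior L) x * a L) = (\<Sum>L\<in>\<K>. if L = K then a L else 0)"
  proof (rule sum.cong[OF refl])
    fix L assume "L \<in> \<K>"
    then have "L \<noteq> K \<Longrightarrow> x \<notin> interior L"
      using assms(2-4) by (auto simp: pairwise_def)
    then show "indicator (interior L) x * a L = (if L = K then a L else 0)"
      using assms(4) by (auto simp: indicator_def)
  qed
  then show ?thesis
    using assms(1,3) by simp
qed

context
  fixes k :: nat and \<Omega> :: "pt set" and \<K> \<F> :: "pt set set"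
  assumes dom: "convex_polygonal_domain \<Omega>" and mesh: "polygonal_mesh \<Omega> \<K> \<F>"
begin

lemma broken_L2:
  assumes q: "q \<in> Vh k \<K> \<F>"
  shows "broken \<K> q \<in> L2 (lebesgue_on \<Omega>)"
proof -
  have "(\<lambda>x. indicator (interior K) x * fst q K x) \<in> L2 (lebesgue_on \<Omega>)" if K: "K \<in> \<K>" for K
  proof -
    note gK = mesh_good_cell[OF mesh K]
    have qK: "fst q K \<in> L2 (lebesgue_on K)"
      by (rule Pk_L2_cell[OF gK VhD(1)[OF q K]])
    have "integrable (lebesgue_on \<Omega>) (\<lambda>x. indicator (interior K) x * (fst q K x)\<^sup>2)"
      by (rule integral_interior[OF gK mesh_domain(1)[OF dom mesh] mesh_domain(2)[OF dom mesh K]])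
        (use qK in \<open>simp add: L2_def\<close>)
    also have "(\<lambda>x. indicator (interior K) x * (fst q K x)\<^sup>2)
        = (\<lambda>x. (indicator (interior K) x * fst q K x)\<^sup>2)"
      by (auto simp: indicator_def fun_eq_iff)
    finally have i: "integrable (lebesgue_on \<Omega>) (\<lambda>x. (indicator (interior K) x * fst q K x)\<^sup>2)" .
    \<comment> \<open>Integrability of the function itself serves to extract its measurability on
      the domain.\<close>
    have "integrable (lebesgue_on K) (fst q K)"
      using gK cont_gradD(1)[OF Pk_cont_grad[OF VhD(1)[OF q K]]]
      by (intro integrable_lebesgue_on_compact) (auto simp: good_cell_def intro: continuous_on_subset)
    from integral_interior(1)[OF gK mesh_domain(1)[OF dom mesh] mesh_domain(2)[OF dom mesh K] this] i
    show ?thesis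
      unfolding L2_def by (auto dest: borel_measurable_integrable)
  qed
  from fun_subspace_sum[OF fun_subspace_L2 this, where c = "\<lambda>_. 1"]
  show ?thesis
    unfolding broken_def[abs_def] by simp
qed

text \<open>Cross terms vanish pointwise because at most one cell has a given point in its
  interior.\<close>

lemma broken_norm:
  assumes q: "q \<in> Vh k \<K> \<F>"
  shows "l2_inner (lebesgue_on \<Omega>) (broken \<K> q) (broken \<K> q)
    = (\<Sum>K\<in>\<K>. l2_inner (lebesgue_on K) (fst q K) (fst q K))"
proof -
  note fin = mesh_domain(3)[OF dom mesh] and dis = mesh_domain(4)[OF dom mesh]
  have qq: "integrable (lebesgue_on K) (\<lambda>x. fst q K x * fst q K x)" if "K \<in> \<K>" for K
    using Pk_L2_cell[OF mesh_good_cell[OF mesh that] VhD(1)[OF q that]]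
    by (intro L2_integrable_mult)
  note qi = integral_interior[OF mesh_good_cell[OF mesh] mesh_domain(1)[OF dom mesh]
      mesh_domain(2)[OF dom mesh] qq]
  have "broken \<K> q x * broken \<K> q x
      = (\<Sum>K\<in>\<K>. indicator (interior K) x * (fst q K x * fst q K x))" for x
  proof (cases "\<exists>K\<in>\<K>. x \<in> interior K")
    case True
    then obtain K where K: "K \<in> \<K>" "x \<in> interior K" by blast
    show ?thesis
      unfolding broken_def
      using disjoint_indicator_sum[OF fin dis K, of "\<lambda>K. fst q K x"]
        disjoint_indicator_sum[OF fin dis K, of "\<lambda>K. fst q K x * fst q K x"] by simp
  qed (simp add: broken_def)
  then have "l2_inner (lebesgue_on \<Omega>) (broken \<K> q) (broken \<K> q)
      = (\<integral>x. (\<Sum>K\<in>\<K>. indicator (interior K) x * (fst q K x * fst q K x)) \<partial>lebesgue_on \<Omega>)"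
    by (simp add: l2_inner_def)
  also have "\<dots> = (\<Sum>K\<in>\<K>. \<integral>x. indicator (interior K) x * (fst q K x * fst q K x) \<partial>lebesgue_on \<Omega>)"
    by (intro Bochner_Integration.integral_sum qi(1))
  also have "\<dots> = (\<Sum>K\<in>\<K>. l2_inner (lebesgue_on K) (fst q K) (fst q K))"
    unfolding l2_inner_def by (intro sum.cong refl qi(2))
  finally show ?thesis .
qed

text \<open>Pointwise, the cell contributions add up to \<open>g x * g x\<close> inside a cell and
  to 0 elsewhere.\<close>

lemma sum_cells_norm_le:
  assumes g: "g \<in> L2 (lebesgue_on \<Omega>)"
  shows "(\<Sum>K\<in>\<K>. l2_inner (lebesgue_on K) g g) \<le> l2_inner (lebesgue_on \<Omega>) g g"
proof -
  note fin = mesh_domain(3)[OF dom mesh] and dis = mesh_domain(4)[OF dom mesh]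
  have gg: "integrable (lebesgue_on K) (\<lambda>x. g x * g x)" if "K \<in> \<K>" for K
    using L2_on_cell[OF mesh_good_cell[OF mesh that] mesh_domain(1)[OF dom mesh]
        mesh_domain(2)[OF dom mesh that] g]
    by (intro L2_integrable_mult)
  note gi = integral_interior[OF mesh_good_cell[OF mesh] mesh_domain(1)[OF dom mesh]
      mesh_domain(2)[OF dom mesh] gg]
  have "(\<Sum>K\<in>\<K>. l2_inner (lebesgue_on K) g g)
      = (\<Sum>K\<in>\<K>. \<integral>x. indicator (interior K) x * (g x * g x) \<partial>lebesgue_on \<Omega>)"
    unfolding l2_inner_def by (intro sum.cong refl gi(2)[symmetric])
  also have "\<dots> = (\<integral>x. (\<Sum>K\<in>\<K>. indicator (interior K) x * (g x * g x)) \<partial>lebesgue_on \<Omega>)"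
    by (intro Bochner_Integration.integral_sum[symmetric] gi(1))
  also have "\<dots> \<le> l2_inner (lebesgue_on \<Omega>) g g"
    unfolding l2_inner_def
  proof (intro integral_mono Bochner_Integration.integrable_sum gi(1) L2_integrable_mult g)
    fix x
    show "(\<Sum>K\<in>\<K>. indicator (interior K) x * (g x * g x)) \<le> g x * g x"
    proof (cases "\<exists>K\<in>\<K>. x \<in> interior K")
      case True
      then obtain K where "K \<in> \<K>" "x \<in> interior K" by blast
      from disjoint_indicator_sum[OF fin dis this, of "\<lambda>_. g x * g x"] show ?thesis
        by simp
    qed simp
  qed
  finally show ?thesis .
qed

lemma broken_projection_le:
  assumes g: "g \<in> L2 (lebesgue_on \<Omega>)" and q: "q \<in> Vh k \<K> \<F>"
    and "\<And>K. K \<in> \<K> \<Longrightarrow> fst q K = proj_cell k K g"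
  shows "l2_inner (lebesgue_on \<Omega>) (broken \<K> q) (broken \<K> q) \<le> l2_inner (lebesgue_on \<Omega>) g g"
proof -
  have "(\<Sum>K\<in>\<K>. l2_inner (lebesgue_on K) (fst q K) (fst q K))
      \<le> (\<Sum>K\<in>\<K>. l2_inner (lebesgue_on K) g g)"
    using proj_cell_le[OF mesh_good_cell[OF mesh] L2_on_cell[OF mesh_good_cell[OF mesh]
          mesh_domain(1)[OF dom mesh] mesh_domain(2)[OF dom mesh] g]] assms(3)
    by (intro sum_mono) simp
  with broken_norm[OF q] sum_cells_norm_le[OF g] show ?thesis
    by simp
qed

end

section \<open>Half-step averages as test functions\<close>

lemma broken_half_hybrid: "broken \<K> (half_hybrid P n) = half_scalar (\<lambda>m. broken \<K> (P m)) n"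
  unfolding broken_def half_hybrid_def half_scalar_def
  by (simp add: add_divide_distrib distrib_left sum.distrib sum_divide_distrib)

lemma half_scalar_in:
  assumes "fun_subspace V" "u n \<in> V" "u (Suc n) \<in> V"
  shows "half_scalar u n \<in> V"
  using fun_subspaceD(2)[OF assms(1,3,2), of "1/2" "1/2"]
  by (simp add: half_scalar_def add_divide_distrib)

lemma half_hybrid_Vh0:
  assumes "P n \<in> Vh0 k \<Omega> \<K> \<F>" "P (Suc n) \<in> Vh0 k \<Omega> \<K> \<F>"
  shows "half_hybrid P n \<in> Vh0 k \<Omega> \<K> \<F>"
proof -
  have z: "half_scalar u n = (\<lambda>_. 0)" if "u n = (\<lambda>_. 0)" "u (Suc n) = (\<lambda>_. 0)"
    for u :: "nat \<Rightarrow> scalar"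
    using that by (simp add: half_scalar_def)
  have b: "snd (P n) F = (\<lambda>_. 0)" "snd (P (Suc n)) F = (\<lambda>_. 0)"
    if "F \<in> boundary_faces \<Omega> \<F>" for F
    using assms that by (simp_all add: Vh0_def)
  have "half_hybrid P n \<in> Vh k \<K> \<F>"
    unfolding Vh_def mem_Collect_eq
  proof (intro conjI allI)
    show "if K \<in> \<K> then fst (half_hybrid P n) K \<in> Pk k else fst (half_hybrid P n) K = (\<lambda>_. 0)" for K
      using assms unfolding Vh0_def Vh_def half_hybrid_def
      by (simp add: z half_scalar_in[OF fun_subspace_Pk])
    show "if F \<in> \<F> then snd (half_hybrid P n) F \<in> Pk_face k F else snd (half_hybrid P n) F = (\<lambda>_. 0)" for F
      using assms unfolding Vh0_def Vh_def half_hybrid_def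
      by (simp add: z half_scalar_in[OF fun_subspace_Pk_face])
  qed
  moreover have "snd (half_hybrid P n) F = (\<lambda>_. 0)" if "F \<in> boundary_faces \<Omega> \<F>" for F
    unfolding half_hybrid_def using z b[OF that] by simp
  ultimately show ?thesis
    by (simp add: Vh0_def)
qed

section \<open>The energy estimate\<close>

text \<open>Four independent coefficients cover both the product of difference quotient and average,
  where the mixed terms cancel, and the squares of averages.\<close>

lemma semi_inner_expand:
  assumes B: "semi_inner V B" and u: "u \<in> V" and v: "v \<in> V"
  shows "B (\<lambda>x. a * u x + b * v x) (\<lambda>x. c * u x + d * v x)
    = a * c * B u u + (a * d + b * c) * B u v + b * d * B v v"
proof -
  have w: "(\<lambda>x. c * u x + d * v x) \<in> V"
    by (rule fun_subspaceD(2)[OF semi_innerD(1)[OF B] u v])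
  show ?thesis
    using linear_on_funsD(1)[OF semi_innerD(2)[OF B w] u v, of a b]
      linear_on_funsD(1)[OF semi_innerD(3)[OF B u] u v, of c d]
      linear_on_funsD(1)[OF semi_innerD(3)[OF B v] u v, of c d] semi_innerD(4)[OF B u v]
    by (simp add: algebra_simps)
qed

text \<open>Nonnegativity of the form at \<open>s u - v\<close>, divided by
  \<open>s\<close>.\<close>

lemma semi_inner_young:
  assumes B: "semi_inner V B" and u: "u \<in> V" and v: "v \<in> V" and s: "0 < s"
  shows "2 * B u v \<le> s * B u u + B v v / s"
proof -
  have "(\<lambda>x. s * u x + (-1) * v x) \<in> V"
    by (rule fun_subspaceD(2)[OF semi_innerD(1)[OF B] u v])
  from semi_innerD(5)[OF B this]
  have "0 \<le> s * s * B u u - 2 * s * B u v + B v v"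
    unfolding semi_inner_expand[OF B u v] by simp
  then have "s * (2 * B u v) \<le> s * (s * B u u + B v v / s)"
    using s by (simp add: algebra_simps)
  then show ?thesis
    using s by simp
qed

text \<open>Instead of a discrete Gronwall argument: the source contributes at most half of the largest
  energy attained, which is absorbed at the step where the maximum is attained.\<close>

lemma energy_bound:
  fixes a E b F u :: "nat \<Rightarrow> real" and T \<tau> :: real
  assumes T: "0 < T" and \<tau>: "0 \<le> \<tau>" "real (Suc l) * \<tau> \<le> T"
    and step: "\<And>n. n \<le> l \<Longrightarrow>
      a (Suc n) - a n + 2 * \<tau> * b n + (E (Suc n) - E n) \<le> \<tau> * (2 * T * F n + u n / (2 * T))"
    and u: "\<And>n. n \<le> l \<Longrightarrow> u n \<le> (a (Suc n) + a n) / 2"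
    and E: "E 0 = 0" "\<And>n. n \<le> Suc l \<Longrightarrow> 0 \<le> E n"
    and nonneg: "\<And>n. 0 \<le> b n" "\<And>n. 0 \<le> F n" "\<And>n. 0 \<le> a n"
  shows "a (Suc l) + \<tau> * (\<Sum>n=0..l. b n) \<le> 2 * a 0 + 4 * T * (\<tau> * (\<Sum>n=0..l. F n))"
proof -
  define A where "A = Max (a ` {..Suc l})"
  define D where "D = a 0 + 2 * T * (\<tau> * (\<Sum>n=0..l. F n))"
  have A: "a n \<le> A" if "n \<le> Suc l" for n
    unfolding A_def by (rule Max_ge) (use that in auto)
  have A0: "0 \<le> A"
    using A[of 0] nonneg(3)[of 0] by simp
  have sum: "a m + 2 * \<tau> * (\<Sum>n<m. b n) + E m
      \<le> a 0 + 2 * T * (\<tau> * (\<Sum>n<m. F n)) + real m * (\<tau> * (A / (2 * T)))" if "m \<le> Suc l" for m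
    using that
  proof (induction m)
    case 0
    then show ?case using E by simp
  next
    case (Suc m)
    have "u m \<le> A"
      using u[of m] A[of m] A[of "Suc m"] Suc.prems by simp
    then have "\<tau> * (u m / (2 * T)) \<le> \<tau> * (A / (2 * T))"
      using T \<tau> by (intro mult_left_mono divide_right_mono) auto
    moreover have "real (Suc m) * c = real m * c + c" for c
      by (simp add: distrib_right)
    moreover have "\<tau> * (2 * T * F m) = 2 * T * (\<tau> * F m)"
      by simp
    ultimately show ?case
      using Suc.IH[OF Suc_leD[OF Suc.prems]] step[OF Suc_le_mono[THEN iffD1, OF Suc.prems]]
      unfolding sum.lessThan_Suc distrib_left by (simp only:)
  qed
  \<comment> \<open>At most T / \<open>\<tau>\<close> steps occur, so the accumulated source charge
    \<open>m \<tau> A / (2 T)\<close> is at most \<open>A / 2\<close>.\<close>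
  have bound: "a m + 2 * \<tau> * (\<Sum>n<m. b n) \<le> D + A / 2" if m: "m \<le> Suc l" for m
  proof -
    have "real m * \<tau> \<le> T"
      using \<tau> m by (meson mult_right_mono of_nat_mono order_trans)
    then have "(real m * \<tau>) * (A / (2 * T)) \<le> T * (A / (2 * T))"
      using A0 T by (intro mult_right_mono) auto
    also have "\<dots> = A / 2"
      using T by simp
    finally have 1: "real m * (\<tau> * (A / (2 * T))) \<le> A / 2"
      by (simp add: mult.assoc)
    have "(\<Sum>n<m. F n) \<le> (\<Sum>n=0..l. F n)"
      by (rule sum_mono2) (use m nonneg in auto)
    then have "2 * T * (\<tau> * (\<Sum>n<m. F n)) \<le> 2 * T * (\<tau> * (\<Sum>n=0..l. F n))"
      using T \<tau> by (intro mult_left_mono) auto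
    then show ?thesis
      using sum[OF m] 1 E(2)[OF m] unfolding D_def by linarith
  qed
  have "A \<in> a ` {..Suc l}"
    unfolding A_def by (rule Max_in) auto
  then obtain m where m: "m \<le> Suc l" "A = a m"
    by auto
  have "0 \<le> 2 * \<tau> * (\<Sum>n<m. b n)"
    using \<tau> nonneg by (intro mult_nonneg_nonneg sum_nonneg) auto
  \<comment> \<open>At the index where the maximum is attained, the bound reads
    \<open>A \<le> D + A / 2\<close>. Inserting the result into the bound at the last index gives
    \<open>2 * D\<close> there as well.\<close>
  then have "A \<le> 2 * D"
    using bound[OF m(1)] m(2) by linarith
  then have *: "a (Suc l) + 2 * \<tau> * (\<Sum>n<Suc l. b n) \<le> 2 * D"
    using bound[of "Suc l"] by simp
  have "{..<Suc l} = {0..l}"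
    by auto
  moreover have "0 \<le> \<tau> * (\<Sum>n=0..l. b n)"
    using \<tau> nonneg by (intro mult_nonneg_nonneg sum_nonneg) auto
  ultimately show ?thesis
    using * unfolding D_def by (simp add: algebra_simps)
qed

text \<open>The added row and column have equal sums, so the older terms get twice the weight of the
  corner, matching the weights \<open>\<tau>\<close> and \<open>\<tau> / 2\<close> of the memory
  term.\<close>

lemma sum_square_Suc:
  fixes b :: "nat \<Rightarrow> nat \<Rightarrow> real"
  assumes "\<And>i j. b i j = b j i"
  shows "(\<Sum>i<Suc n. \<Sum>j<Suc n. b i j) = (\<Sum>i<n. \<Sum>j<n. b i j) + 2 * (\<Sum>j<n. b j n) + b n n"
proof -
  have "(\<Sum>j<n. b n j) = (\<Sum>j<n. b j n)"
    using assms by (rule sum.cong[OF refl])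
  then show ?thesis
    by (simp add: sum.distrib)
qed

lemma hho_energy_bound:
  assumes dom: "convex_polygonal_domain \<Omega>" and mesh: "polygonal_mesh \<Omega> \<K> \<F>"
    and T: "0 < T" and M: "0 < M" and \<tau>: "\<tau> = T / real M"
    and g: "g \<in> L2 (lebesgue_on \<Omega>)" and f: "\<And>t. t \<in> {0..T} \<Longrightarrow> f t \<in> L2 (lebesgue_on \<Omega>)"
    and sol: "hho_solution k \<Omega> \<K> \<F> \<tau> M g f P" and l: "Suc l \<le> M"
  shows "(l2_norm (lebesgue_on \<Omega>) (broken \<K> (P (Suc l))))\<^sup>2
         + \<tau> * (\<Sum>n=0..l. (norm1h k \<K> \<F> (half_hybrid P n))\<^sup>2)
       \<le> 2 * (l2_norm (lebesgue_on \<Omega>) g)\<^sup>2 + 4 * T * (\<tau> * (\<Sum>n=0..l.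
               (l2_norm (lebesgue_on \<Omega>) (half_scalar (\<lambda>m. f (real m * \<tau>)) n))\<^sup>2))"
proof -
  let ?I = "l2_inner (lebesgue_on \<Omega>)" and ?b = "bform k \<K> \<F>"
  let ?Q = "half_hybrid P"
  define U where "U n = broken \<K> (P n)" for n
  define fh where "fh = half_scalar (\<lambda>m. f (real m * \<tau>))"
  define G where "G n = (\<Sum>i<n. \<Sum>j<n. ?b (?Q i) (?Q j))" for n
  note B = semi_inner_L2[of "lebesgue_on \<Omega>"]
  have \<tau>0: "0 < \<tau>"
    using T M \<tau> by simp
  have M\<tau>: "real M * \<tau> = T"
    using M \<tau> by simp
  have mT: "real m * \<tau> \<le> T" if "m \<le> M" for m
    using mult_right_mono[of "real m" "real M" \<tau>] that \<tau>0 M\<tau> by simp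
  have normsq: "(l2_norm (lebesgue_on \<Omega>) u)\<^sup>2 = ?I u u" for u
    by (simp add: l2_norm_def l2_inner_def)
  have P: "P n \<in> Vh0 k \<Omega> \<K> \<F>" if "n \<le> M" for n
    using sol that by (simp add: hho_solution_def)
  have Vh: "q \<in> Vh k \<K> \<F>" if "q \<in> Vh0 k \<Omega> \<K> \<F>" for q
    using that by (simp add: Vh0_def)
  have U: "U n \<in> L2 (lebesgue_on \<Omega>)" if "n \<le> M" for n
    unfolding U_def by (rule broken_L2[OF dom mesh Vh[OF P[OF that]]])
  have Q: "?Q n \<in> Vh0 k \<Omega> \<K> \<F>" if "n < M" for n
    by (rule half_hybrid_Vh0) (use P that in simp_all)
  have F: "fh n \<in> L2 (lebesgue_on \<Omega>)" if "n < M" for n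
    unfolding fh_def
    by (rule half_scalar_in[OF fun_subspace_L2]; rule f)
      (use mT[of n] mT[of "Suc n"] that \<tau>0 in auto)
  have hU: "broken \<K> (?Q n) = (\<lambda>x. (1/2) * U (Suc n) x + (1/2) * U n x)" for n
    unfolding broken_half_hybrid U_def half_scalar_def by (simp add: add_divide_distrib)
  have dU: "time_diff \<tau> (\<lambda>m. broken \<K> (P m)) n = (\<lambda>x. (1/\<tau>) * U (Suc n) x + (-1/\<tau>) * U n x)" for n
    unfolding U_def time_diff_def by (simp add: diff_divide_distrib)
  have psd: "0 \<le> G n" if "n \<le> M" for n
    using pos_kernel_bform[OF mesh, of k, unfolded pos_kernel_def, rule_format, of n ?Q] Vh[OF Q] that
    unfolding G_def by simp
  have b0: "0 \<le> ?b (?Q n) (?Q n)" if "n < M" for n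
    using pos_kernel_bform[OF mesh, of k, unfolded pos_kernel_def, rule_format, of 1 "\<lambda>_. ?Q n"]
      Vh[OF Q[OF that]] by simp
  have mem: "memory_term k \<K> \<F> \<tau> P n (?Q n) = \<tau> / 2 * (G (Suc n) - G n)" for n
    unfolding memory_term_def G_def sum_square_Suc[of "\<lambda>i j. ?b (?Q i) (?Q j)", OF bform_commute]
    by (simp add: algebra_simps)
  have step: "?I (U (Suc n)) (U (Suc n)) - ?I (U n) (U n) + 2 * \<tau> * ?b (?Q n) (?Q n)
      + (\<tau>\<^sup>2 * G (Suc n) - \<tau>\<^sup>2 * G n)
      \<le> \<tau> * (2 * T * ?I (fh n) (fh n) + ?I (broken \<K> (?Q n)) (broken \<K> (?Q n)) / (2 * T))"
    if n: "n < M" for n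
  proof -
    have Un: "U (Suc n) \<in> L2 (lebesgue_on \<Omega>)" "U n \<in> L2 (lebesgue_on \<Omega>)"
      using U n by simp_all
    have "?I (time_diff \<tau> (\<lambda>m. broken \<K> (P m)) n) (broken \<K> (?Q n)) + ?b (?Q n) (?Q n)
        + memory_term k \<K> \<F> \<tau> P n (?Q n) = ?I (fh n) (broken \<K> (?Q n))"
      using sol Q[OF n] n unfolding hho_solution_def fh_def by blast
    \<comment> \<open>The factor \<open>2 * \<tau>\<close> turns the difference quotient tested with
      the average into the exact difference of consecutive energies.\<close>
    from arg_cong[OF this, of "\<lambda>x. 2 * \<tau> * x"]
    have "2 * \<tau> * ?I (time_diff \<tau> (\<lambda>m. broken \<K> (P m)) n) (broken \<K> (?Q n))
        + 2 * \<tau> * ?b (?Q n) (?Q n) + 2 * \<tau> * memory_term k \<K> \<F> \<tau> P n (?Q n)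
        = 2 * \<tau> * ?I (fh n) (broken \<K> (?Q n))"
      unfolding distrib_left .
    moreover have "2 * \<tau> * ?I (time_diff \<tau> (\<lambda>m. broken \<K> (P m)) n) (broken \<K> (?Q n))
        = ?I (U (Suc n)) (U (Suc n)) - ?I (U n) (U n)"
      unfolding hU dU semi_inner_expand[OF B Un] using \<tau>0 by (simp add: field_simps)
    moreover have "2 * \<tau> * memory_term k \<K> \<F> \<tau> P n (?Q n) = \<tau>\<^sup>2 * G (Suc n) - \<tau>\<^sup>2 * G n"
      unfolding mem by (simp add: power2_eq_square algebra_simps)
    ultimately have "?I (U (Suc n)) (U (Suc n)) - ?I (U n) (U n) + 2 * \<tau> * ?b (?Q n) (?Q n)
      + (\<tau>\<^sup>2 * G (Suc n) - \<tau>\<^sup>2 * G n) = 2 * \<tau> * ?I (fh n) (broken \<K> (?Q n))"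
      by linarith
    also have "\<dots> = \<tau> * (2 * ?I (fh n) (broken \<K> (?Q n)))"
      by simp
    \<comment> \<open>Young's inequality with \<open>s = 2 * T\<close>, the source in the first
      slot: the solution receives the small weight \<open>1 / (2 * T)\<close>.\<close>
    also have "\<dots> \<le> \<tau> * (2 * T * ?I (fh n) (fh n) + ?I (broken \<K> (?Q n)) (broken \<K> (?Q n)) / (2 * T))"
      using semi_inner_young[OF B F[OF n] broken_L2[OF dom mesh Vh[OF Q[OF n]]], of "2 * T"] T \<tau>0
      by (intro mult_left_mono) auto
    finally show ?thesis .
  qed
  have half: "?I (broken \<K> (?Q n)) (broken \<K> (?Q n))
      \<le> (?I (U (Suc n)) (U (Suc n)) + ?I (U n) (U n)) / 2" if n: "n < M" for n
  proof -
    have Un: "U (Suc n) \<in> L2 (lebesgue_on \<Omega>)" "U n \<in> L2 (lebesgue_on \<Omega>)"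
      using U n by simp_all
    show ?thesis
      unfolding hU semi_inner_expand[OF B Un] using semi_inner_young[OF B Un, of 1] by simp
  qed
  \<comment> \<open>Valid for every function, integrable or not; \<open>energy_bound\<close> asks
    for nonnegativity at all indices.\<close>
  have I0: "0 \<le> ?I u u" for u
    by (simp add: l2_inner_def)
  \<comment> \<open>Absolute values make the diagonal terms nonnegative at every index, as
    \<open>energy_bound\<close> requires. The form is known to be nonnegative only for
    \<open>n < M\<close>, where they change nothing.\<close>
  have "?I (U (Suc l)) (U (Suc l)) + \<tau> * (\<Sum>n=0..l. \<bar>?b (?Q n) (?Q n)\<bar>)
      \<le> 2 * ?I (U 0) (U 0) + 4 * T * (\<tau> * (\<Sum>n=0..l. ?I (fh n) (fh n)))"
  proof (rule energy_bound[where E = "\<lambda>n. \<tau>\<^sup>2 * G n"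
        and u = "\<lambda>n. ?I (broken \<K> (?Q n)) (broken \<K> (?Q n))"])
    show "real (Suc l) * \<tau> \<le> T"
      by (rule mT[OF l])
    show "\<tau>\<^sup>2 * G 0 = 0"
      by (simp add: G_def)
    show "0 \<le> \<tau>\<^sup>2 * G n" if "n \<le> Suc l" for n
      using psd[of n] that l by simp
    show "?I (U (Suc n)) (U (Suc n)) - ?I (U n) (U n) + 2 * \<tau> * \<bar>?b (?Q n) (?Q n)\<bar>
      + (\<tau>\<^sup>2 * G (Suc n) - \<tau>\<^sup>2 * G n)
      \<le> \<tau> * (2 * T * ?I (fh n) (fh n) + ?I (broken \<K> (?Q n)) (broken \<K> (?Q n)) / (2 * T))"
      if "n \<le> l" for n
      using step[of n] b0[of n] that l by simp
    show "?I (broken \<K> (?Q n)) (broken \<K> (?Q n))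
      \<le> (?I (U (Suc n)) (U (Suc n)) + ?I (U n) (U n)) / 2" if "n \<le> l" for n
      using half[of n] that l by simp
  qed (use T \<tau>0 I0 in auto)
  moreover have "?I (U 0) (U 0) \<le> ?I g g"
    unfolding U_def
    by (rule broken_projection_le[OF dom mesh g Vh[OF P[OF le0]]])
      (use sol in \<open>simp add: hho_solution_def Ih_def\<close>)
  moreover have "(norm1h k \<K> \<F> (?Q n))\<^sup>2 = \<bar>?b (?Q n) (?Q n)\<bar>" if "n \<le> l" for n
    using b0[of n] that l by (simp add: norm1h_def)
  ultimately show ?thesis
    unfolding normsq fh_def[symmetric] U_def[symmetric] by simp
qed

theorem lemma4p1:
  fixes \<Omega> :: "pt set" and T \<rho> :: real and k :: nat
  assumes "convex_polygonal_domain \<Omega>" and "T > 0" and "0 < \<rho>" and "\<rho> < 1"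
  shows "\<exists>C>0. \<forall>\<K> \<F> (M::nat) \<tau> g f P.
    regular_mesh \<rho> \<Omega> \<K> \<F> \<longrightarrow> M > 0 \<longrightarrow> \<tau> = T / real M \<longrightarrow>
    g \<in> H1 \<Omega> \<longrightarrow> (\<forall>t\<in>{0..T}. f t \<in> L2 (lebesgue_on \<Omega>)) \<longrightarrow>
    hho_solution k \<Omega> \<K> \<F> \<tau> M g f P \<longrightarrow>
    (\<forall>l\<in>{1..M - 1}.
       (l2_norm (lebesgue_on \<Omega>) (broken \<K> (P (l + 1))))\<^sup>2
         + \<tau> * (\<Sum>n=0..l. (norm1h k \<K> \<F> (half_hybrid P n))\<^sup>2)
       \<le> C * ((l2_norm (lebesgue_on \<Omega>) g)\<^sup>2
           + \<tau> / 2 * (\<Sum>n=0..l.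
               (l2_norm (lebesgue_on \<Omega>) (half_scalar (\<lambda>m. f (real m * \<tau>)) n))\<^sup>2)))"
\<comment> \<open>The energy bound reads \<open>2 * X + 8 * T * Y\<close> once the factor
  \<open>\<tau> / 2\<close> is moved into \<open>Y\<close>; the sum of both coefficients dominates
  each, as \<open>X\<close> and \<open>Y\<close> are nonnegative.\<close>
proof (intro exI[of _ "2 + 8 * T"] conjI allI impI ballI)
  show "0 < 2 + 8 * T"
    using assms(2) by simp
next
  fix \<K> \<F> :: "pt set set" and M l :: nat and \<tau> :: real and g :: scalar and f :: "real \<Rightarrow> scalar"
    and P :: "nat \<Rightarrow> hybrid"
  assume mesh: "regular_mesh \<rho> \<Omega> \<K> \<F>" and M: "M > 0" and \<tau>: "\<tau> = T / real M"
    and g: "g \<in> H1 \<Omega>" and f: "\<forall>t\<in>{0..T}. f t \<in> L2 (lebesgue_on \<Omega>)"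
    and sol: "hho_solution k \<Omega> \<K> \<F> \<tau> M g f P" and l: "l \<in> {1..M - 1}"
  define X where "X = (l2_norm (lebesgue_on \<Omega>) g)\<^sup>2"
  define Y where "Y = \<tau> / 2 * (\<Sum>n=0..l.
    (l2_norm (lebesgue_on \<Omega>) (half_scalar (\<lambda>m. f (real m * \<tau>)) n))\<^sup>2)"
  have "0 \<le> \<tau>"
    using \<tau> assms(2) by simp
  then have "0 \<le> X" "0 \<le> Y"
    unfolding X_def Y_def by (simp_all add: sum_nonneg)
  then have "2 * X + 8 * T * Y \<le> (2 + 8 * T) * (X + Y)"
    using assms(2) by (simp add: algebra_simps)
  moreover have "g \<in> L2 (lebesgue_on \<Omega>)"
    using g by (simp add: H1_def)
  moreover have "Suc l \<le> M"
    using l M by auto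
  ultimately show "(l2_norm (lebesgue_on \<Omega>) (broken \<K> (P (l + 1))))\<^sup>2
         + \<tau> * (\<Sum>n=0..l. (norm1h k \<K> \<F> (half_hybrid P n))\<^sup>2)
       \<le> (2 + 8 * T) * ((l2_norm (lebesgue_on \<Omega>) g)\<^sup>2
           + \<tau> / 2 * (\<Sum>n=0..l.
               (l2_norm (lebesgue_on \<Omega>) (half_scalar (\<lambda>m. f (real m * \<tau>)) n))\<^sup>2))"
    using hho_energy_bound[OF assms(1) _ assms(2) M \<tau> _ _ sol, of l] mesh f
    by (simp add: X_def Y_def regular_mesh_def)
qed

end
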